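(* Let $\mathcal{C}$ be a semisimple tensor category over $\mathbb{C}$, so that $\mathcal{C}$ is $\phi$-weakly positive for some quasi-pivotal structure $\phi$. Let $X$ be a connected Frobenius algebra in $\mathcal{C}$ such that $\phi_X$ is an algebra morphism. Then every coherent sublattice of the Frobenius subalgebra poset of $X$ is finite. In particular, for every basis $\mathcal{B}$ of $X$, the Frobenius $\mathcal{B}$-subalgebra lattice of $X$ is finite.
   Context: Tensor categories (locally finite linear abelian rigid monoidal, bilinear tensor product, $\mathrm{End}(\mathbf 1)=\mathbb{C}$) are taken strict. A left dual of $X$ is $(X^*,\mathrm{ev}_X:X^*\otimes X\to\mathbf 1,\mathrm{coev}_X:\mathbf 1\to X\otimes X^* )$ satisfying the zigzag identities; $f^*:Y^*\to X^*$ is the dual of $f:X\to Y$. A quasi-pivotal structure is a natural isomorphism $\phi:\mathrm{id}_{\mathcal C}\to(\,)^{**}$ (not required monoidal). For $\alpha:Y\to Y^{**}$, $\mathrm{tr}(\alpha):=\mathrm{ev}_{Y^*}\circ(\alpha\otimes\mathrm{id}_{Y^*})\circ\mathrm{coev}_Y\in\mathbb{C}$. $\mathcal{C}$ is $\phi$-weakly positive if $\phi$ is quasi-pivotal with $\mathrm{tr}(\phi_Y)>0$ for every nonzero object $Y$. A Frobenius algebra is $(X,m,\delta,e,\epsilon)$ with $(X,m,e)$ a unital algebra, $(X,\delta,\epsilon)$ a counital coalgebra and $(\mathrm{id}_X\otimes m)\circ(\delta\otimes \mathrm{id}_X)=\delta\circ m=(m\otimes \mathrm{id}_X)\circ(\mathrm{id}_X\otimes\delta)$.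 It is always regarded as selfdual, $X^*=X$ (hence $X^{**}=X$), with $\mathrm{ev}_X=\epsilon\circ m$, $\mathrm{coev}_X=\delta\circ e$. $X$ is connected if $\dim\mathrm{Hom}(\mathbf 1,X)=1$. "$\phi_X$ is an algebra morphism" means $m\circ(\phi_X\otimes\phi_X)=\phi_X\circ m$. A Frobenius algebra $X'$ is a Frobenius subalgebra of $X$ if there is a unital algebra monomorphism $i:X'\to X$ with $i^{**}=i$, $i^*\circ i=\mathrm{id}_{X'}$; put $b_{X'}:=i\circ i^*$. Two Frobenius subalgebras are equivalent iff their idempotents $b$ coincide; classes are denoted $[X']$; the Frobenius subalgebra poset of $X$ is the set of classes with $[X_1]\le[X_2]$ iff $b_{X_1}\circ b_{X_2}=b_{X_1}=b_{X_2}\circ b_{X_1}$. Ambient selfduality: let $C=C^*$ be selfdual and $(B,i,p)$ a split subobject ($p\circ i=\mathrm{id}_B$), $b=i\circ p$. Split $b^*=i'\circ p'$, $p'\circ i'=\mathrm{id}_{B'}$; the ambient dual of $B$ is $(B',\mathrm{ev}_C\circ(i'\otimes i),(p\otimes p')\circ\mathrm{coev}_C)$ (then $i^*=p'$, $p^*=i'$). $B$ is ambiently selfdual if it coincides with its ambient dual, i.e. one may take $B'=B$, $i'=i$, $p'=p$ (so $i^*=p$, $i^{**}=p^*=i$). A pair $(A,B)$ of subobjects of $X$ is coherent if $A$, $B$, $A\cap B$ (pullback) and $A+B$ (the join in the lattice of subobjects of $X$) are all ambiently selfdual. A sublattice $L$ of the Frobenius subalgebra poset is coherent if it has a bottom element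 and for all $[A],[B]\in L$ the pair $(A,B)$ is coherent and $[A]\wedge[B]=[A\cap B]$. Rigidity invariance. Let $C$ be a semisimple object of finite length. A basis $\mathcal{B}$ of $C$ is a family $(\mathcal{B}_S)_S$, $S$ over representatives of isomorphism classes of simple objects, with $\mathcal{B}_S$ a basis of $\mathrm{Hom}(C,S)$. For each simple $S$, define $\kappa'_{C,S}:\mathrm{Hom}(C,S)\times\mathrm{Hom}(C^*,S^* )\to\mathbb{C}$ by $(f\otimes g)\circ\mathrm{coev}_C=\kappa'_{C,S}(f,g)\,\mathrm{coev}_S$. Let $\langle\cdot,\cdot\rangle$ be the Hermitian form on $\mathrm{Hom}(C,S)$, conjugate-linear in the second argument, for which $\mathcal{B}_S$ is orthonormal, and $M'_{C,S}:\mathrm{Hom}(C^*,S^* )\to\mathrm{Hom}(C,S)$ the conjugate-linear map with $\langle f,M'_{C,S}g\rangle=\kappa'_{C,S}(f,g)$. A split subobject $(A,i,p)$ of $C$ is $\mathcal{B}$-rigid invariant if $M'_{C,S}(\mathrm{Hom}(A^*,S^* )\circ i^* )=\mathrm{Hom}(A,S)\circ p$ for all simple $S$. A Frobenius $\mathcal{B}$-subalgebra of $X$ is a Frobenius subalgebra $A$ such that $(A,i,i^* )$ is $\mathcal{B}$-rigid invariant; the Frobenius $\mathcal{B}$-subalgebra lattice is the subposet of their classes (it is a lattice with $[A]\wedge[B]=[A\cap B]$). *)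

theory Defs
  imports Complex_Main "HOL-Algebra.Lattice"
begin

section \<open>Strict tensor categories over the complex numbers\<close>

text \<open>
  A small strict complex-linear monoidal category: the objects are the elements of the type
  \<open>'o\<close>, and every hom-space is a linear subspace of one ambient complex vector space \<open>'v\<close>
  (for instance of the direct sum of all hom-spaces), so that the library notions of sum, span,
  basis and dimension apply to morphisms.  The subspaces need not be disjoint (all of them contain
  \<open>0\<close>), so a morphism is an element of \<open>'v\<close> considered in a given hom-space.  Nothing is required
  of \<open>comp\<close> and \<open>tmor\<close> on elements that are not composable morphisms, respectively not morphisms.
\<close>

record ('o, 'v) tcat =
  Hom :: "'o \<Rightarrow> 'o \<Rightarrow> 'v set"
  idm :: "'o \<Rightarrow> 'v"
  comp :: "'v \<Rightarrow> 'v \<Rightarrow> 'v" (infixl "\<cdot>\<index>" 70)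
  scl :: "complex \<Rightarrow> 'v \<Rightarrow> 'v"
  unit :: 'o
  tobj :: "'o \<Rightarrow> 'o \<Rightarrow> 'o" (infixr "\<boxdot>\<index>" 75)
  tmor :: "'v \<Rightarrow> 'v \<Rightarrow> 'v" (infixr "\<boxtimes>\<index>" 75)

locale linear_category =
  fixes C :: "('o, 'v::ab_group_add) tcat" (structure)
  assumes vector_space_scl: "vector_space (scl C)"
    and subspace_Hom: "module.subspace (scl C) (Hom C X Y)"
    and idm_Hom: "idm C X \<in> Hom C X X"
    and comp_Hom: "\<lbrakk>f \<in> Hom C X Y; g \<in> Hom C Y Z\<rbrakk> \<Longrightarrow> g \<cdot> f \<in> Hom C X Z"
    and comp_assoc: "\<lbrakk>f \<in> Hom C X Y; g \<in> Hom C Y Z; h \<in> Hom C Z W\<rbrakk>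
          \<Longrightarrow> h \<cdot> (g \<cdot> f) = (h \<cdot> g) \<cdot> f"
    and comp_idm_left: "f \<in> Hom C X Y \<Longrightarrow> idm C Y \<cdot> f = f"
    and comp_idm_right: "f \<in> Hom C X Y \<Longrightarrow> f \<cdot> idm C X = f"
    and comp_add_left: "\<lbrakk>f \<in> Hom C X Y; g \<in> Hom C Y Z; g' \<in> Hom C Y Z\<rbrakk>
          \<Longrightarrow> (g + g') \<cdot> f = g \<cdot> f + g' \<cdot> f"
    and comp_add_right: "\<lbrakk>f \<in> Hom C X Y; f' \<in> Hom C X Y; g \<in> Hom C Y Z\<rbrakk>
          \<Longrightarrow> g \<cdot> (f + f') = g \<cdot> f + g \<cdot> f'"
    and comp_scl_left: "\<lbrakk>f \<in> Hom C X Y; g \<in> Hom C Y Z\<rbrakk>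
          \<Longrightarrow> scl C c g \<cdot> f = scl C c (g \<cdot> f)"
    and comp_scl_right: "\<lbrakk>f \<in> Hom C X Y; g \<in> Hom C Y Z\<rbrakk>
          \<Longrightarrow> g \<cdot> scl C c f = scl C c (g \<cdot> f)"

locale linear_monoidal_category = linear_category +
  assumes tobj_assoc: "(X \<boxdot> Y) \<boxdot> Z = X \<boxdot> (Y \<boxdot> Z)"
    and tobj_unit_left: "unit C \<boxdot> X = X"
    and tobj_unit_right: "X \<boxdot> unit C = X"
    and tmor_Hom: "\<lbrakk>f \<in> Hom C X Y; g \<in> Hom C Z W\<rbrakk> \<Longrightarrow> f \<boxtimes> g \<in> Hom C (X \<boxdot> Z) (Y \<boxdot> W)"
    and tmor_idm: "idm C X \<boxtimes> idm C Y = idm C (X \<boxdot> Y)"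
    and tmor_comp: "\<lbrakk>f \<in> Hom C X Y; f' \<in> Hom C Y Z; g \<in> Hom C U V; g' \<in> Hom C V W\<rbrakk>
          \<Longrightarrow> (f' \<cdot> f) \<boxtimes> (g' \<cdot> g) = (f' \<boxtimes> g') \<cdot> (f \<boxtimes> g)"
    and tmor_assoc: "\<lbrakk>f \<in> Hom C X X'; g \<in> Hom C Y Y'; h \<in> Hom C Z Z'\<rbrakk>
          \<Longrightarrow> (f \<boxtimes> g) \<boxtimes> h = f \<boxtimes> (g \<boxtimes> h)"
    and tmor_unit_left: "f \<in> Hom C X Y \<Longrightarrow> idm C (unit C) \<boxtimes> f = f"
    and tmor_unit_right: "f \<in> Hom C X Y \<Longrightarrow> f \<boxtimes> idm C (unit C) = f"
    and tmor_add_left: "\<lbrakk>f \<in> Hom C X Y; f' \<in> Hom C X Y; g \<in> Hom C Z W\<rbrakk>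
          \<Longrightarrow> (f + f') \<boxtimes> g = f \<boxtimes> g + f' \<boxtimes> g"
    and tmor_add_right: "\<lbrakk>f \<in> Hom C X Y; g \<in> Hom C Z W; g' \<in> Hom C Z W\<rbrakk>
          \<Longrightarrow> f \<boxtimes> (g + g') = f \<boxtimes> g + f \<boxtimes> g'"
    and tmor_scl_left: "\<lbrakk>f \<in> Hom C X Y; g \<in> Hom C Z W\<rbrakk>
          \<Longrightarrow> scl C c f \<boxtimes> g = scl C c (f \<boxtimes> g)"
    and tmor_scl_right: "\<lbrakk>f \<in> Hom C X Y; g \<in> Hom C Z W\<rbrakk>
          \<Longrightarrow> f \<boxtimes> scl C c g = scl C c (f \<boxtimes> g)"


subsection \<open>Abelian structure, simple objects, length\<close>

definition mono_in :: "('o, 'v) tcat \<Rightarrow> 'o \<Rightarrow> 'o \<Rightarrow> 'v \<Rightarrow> bool" where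
  "mono_in C X Y f \<longleftrightarrow> f \<in> Hom C X Y \<and>
     (\<forall>W. \<forall>g\<in>Hom C W X. \<forall>h\<in>Hom C W X. f \<cdot>\<^bsub>C\<^esub> g = f \<cdot>\<^bsub>C\<^esub> h \<longrightarrow> g = h)"

definition epi_in :: "('o, 'v) tcat \<Rightarrow> 'o \<Rightarrow> 'o \<Rightarrow> 'v \<Rightarrow> bool" where
  "epi_in C X Y f \<longleftrightarrow> f \<in> Hom C X Y \<and>
     (\<forall>W. \<forall>g\<in>Hom C Y W. \<forall>h\<in>Hom C Y W. g \<cdot>\<^bsub>C\<^esub> f = h \<cdot>\<^bsub>C\<^esub> f \<longrightarrow> g = h)"

definition iso_in :: "('o, 'v) tcat \<Rightarrow> 'o \<Rightarrow> 'o \<Rightarrow> 'v \<Rightarrow> bool" where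
  "iso_in C X Y f \<longleftrightarrow> f \<in> Hom C X Y \<and>
     (\<exists>g\<in>Hom C Y X. g \<cdot>\<^bsub>C\<^esub> f = idm C X \<and> f \<cdot>\<^bsub>C\<^esub> g = idm C Y)"

definition zero_object :: "('o, 'v::ab_group_add) tcat \<Rightarrow> 'o \<Rightarrow> bool" where
  "zero_object C Z \<longleftrightarrow> (\<forall>Y. Hom C Z Y = {0} \<and> Hom C Y Z = {0})"

definition is_kernel :: "('o, 'v::ab_group_add) tcat \<Rightarrow> 'o \<Rightarrow> 'o \<Rightarrow> 'v \<Rightarrow> 'o \<Rightarrow> 'v \<Rightarrow> bool" where
  "is_kernel C X Y f K k \<longleftrightarrow> f \<in> Hom C X Y \<and> k \<in> Hom C K X \<and> f \<cdot>\<^bsub>C\<^esub> k = 0 \<and>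
     (\<forall>W. \<forall>g\<in>Hom C W X. f \<cdot>\<^bsub>C\<^esub> g = 0 \<longrightarrow> (\<exists>!u\<in>Hom C W K. k \<cdot>\<^bsub>C\<^esub> u = g))"

definition is_cokernel :: "('o, 'v::ab_group_add) tcat \<Rightarrow> 'o \<Rightarrow> 'o \<Rightarrow> 'v \<Rightarrow> 'o \<Rightarrow> 'v \<Rightarrow> bool" where
  "is_cokernel C X Y f Q q \<longleftrightarrow> f \<in> Hom C X Y \<and> q \<in> Hom C Y Q \<and> q \<cdot>\<^bsub>C\<^esub> f = 0 \<and>
     (\<forall>W. \<forall>g\<in>Hom C Y W. g \<cdot>\<^bsub>C\<^esub> f = 0 \<longrightarrow> (\<exists>!u\<in>Hom C Q W. u \<cdot>\<^bsub>C\<^esub> q = g))"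

definition is_direct_sum ::
    "('o, 'v::ab_group_add) tcat \<Rightarrow> nat \<Rightarrow> (nat \<Rightarrow> 'o) \<Rightarrow> 'o \<Rightarrow> (nat \<Rightarrow> 'v) \<Rightarrow> (nat \<Rightarrow> 'v) \<Rightarrow> bool" where
  "is_direct_sum C n Xs Y i p \<longleftrightarrow>
     (\<forall>k<n. i k \<in> Hom C (Xs k) Y \<and> p k \<in> Hom C Y (Xs k)) \<and>
     (\<forall>k<n. \<forall>l<n. p k \<cdot>\<^bsub>C\<^esub> i l = (if k = l then idm C (Xs k) else 0)) \<and>
     (\<Sum>k<n. i k \<cdot>\<^bsub>C\<^esub> p k) = idm C Y"

definition simple_object :: "('o, 'v::ab_group_add) tcat \<Rightarrow> 'o \<Rightarrow> bool" where
  "simple_object C S \<longleftrightarrow> \<not> zero_object C S \<and>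
     (\<forall>A f. mono_in C A S f \<longrightarrow> zero_object C A \<or> iso_in C A S f)"

definition finite_length :: "('o, 'v::ab_group_add) tcat \<Rightarrow> 'o \<Rightarrow> bool" where
  "finite_length C X \<longleftrightarrow> (\<exists>n Y i. zero_object C (Y 0) \<and> Y n = X \<and>
     (\<forall>k<n. mono_in C (Y k) (Y (Suc k)) (i k) \<and>
        (\<exists>S q. simple_object C S \<and> is_cokernel C (Y k) (Y (Suc k)) (i k) S q)))"

definition semisimple_object :: "('o, 'v::ab_group_add) tcat \<Rightarrow> 'o \<Rightarrow> bool" where
  "semisimple_object C X \<longleftrightarrow>
     (\<exists>n S i p. (\<forall>k<n. simple_object C (S k)) \<and> is_direct_sum C n S X i p)"

locale linear_abelian_category = linear_category +
  assumes ex_zero_object: "\<exists>Z. zero_object C Z"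
    and ex_biproduct: "\<exists>Y i p. is_direct_sum C 2 Xs Y i p"
    and ex_kernel: "f \<in> Hom C X Y \<Longrightarrow> \<exists>K k. is_kernel C X Y f K k"
    and ex_cokernel: "f \<in> Hom C X Y \<Longrightarrow> \<exists>Q q. is_cokernel C X Y f Q q"
    and mono_normal: "mono_in C X Y f \<Longrightarrow> \<exists>Z g. is_kernel C Y Z g X f"
    and epi_normal: "epi_in C X Y f \<Longrightarrow> \<exists>Z g. is_cokernel C Z X g Y f"


subsection \<open>Duals and tensor categories\<close>

record ('o, 'v) dual_data =
  dobj :: 'o
  dev :: 'v
  dcoev :: 'v

definition is_left_dual :: "('o, 'v) tcat \<Rightarrow> 'o \<Rightarrow> ('o, 'v) dual_data \<Rightarrow> bool" where
  "is_left_dual C X d \<longleftrightarrow>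
     dev d \<in> Hom C (dobj d \<boxdot>\<^bsub>C\<^esub> X) (unit C) \<and>
     dcoev d \<in> Hom C (unit C) (X \<boxdot>\<^bsub>C\<^esub> dobj d) \<and>
     (idm C X \<boxtimes>\<^bsub>C\<^esub> dev d) \<cdot>\<^bsub>C\<^esub> (dcoev d \<boxtimes>\<^bsub>C\<^esub> idm C X) = idm C X \<and>
     (dev d \<boxtimes>\<^bsub>C\<^esub> idm C (dobj d)) \<cdot>\<^bsub>C\<^esub> (idm C (dobj d) \<boxtimes>\<^bsub>C\<^esub> dcoev d) = idm C (dobj d)"

text \<open>The dual \<open>f\<^sup>* : Y\<^sup>* \<rightarrow> X\<^sup>*\<close> of \<open>f : X \<rightarrow> Y\<close> relative to given left duals \<open>dX\<close>, \<open>dY\<close> of \<open>X\<close>, \<open>Y\<close>.\<close>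

definition dual_mor ::
    "('o, 'v) tcat \<Rightarrow> ('o, 'v) dual_data \<Rightarrow> ('o, 'v) dual_data \<Rightarrow> 'v \<Rightarrow> 'v" where
  "dual_mor C dX dY f =
     (dev dY \<boxtimes>\<^bsub>C\<^esub> idm C (dobj dX)) \<cdot>\<^bsub>C\<^esub>
     (idm C (dobj dY) \<boxtimes>\<^bsub>C\<^esub> f \<boxtimes>\<^bsub>C\<^esub> idm C (dobj dX)) \<cdot>\<^bsub>C\<^esub>
     (idm C (dobj dY) \<boxtimes>\<^bsub>C\<^esub> dcoev dX)"

text \<open>
  In \<open>right_dual\<close>, a right dual of \<open>X\<close> is expressed as an object having \<open>X\<close> as a left dual.
\<close>

locale tensor_category = linear_monoidal_category + linear_abelian_category +
  assumes Hom_finite_dim: "\<exists>B. finite B \<and> Hom C X Y = module.span (scl C) B"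
    and object_finite_length: "finite_length C X"
    and left_dual: "\<exists>d. is_left_dual C X d"
    and right_dual: "\<exists>Z d. is_left_dual C Z d \<and> dobj d = X"
    and End_unit: "Hom C (unit C) (unit C) = range (\<lambda>c. scl C c (idm C (unit C)))"
    and idm_unit_nonzero: "idm C (unit C) \<noteq> 0"

locale semisimple_tensor_category = tensor_category +
  assumes semisimple: "semisimple_object C X"


section \<open>Quasi-pivotal structures and weak positivity\<close>

text \<open>
  \<open>D\<close> is a choice of a left dual for every object; it determines the functor \<open>( )\<^sup>*\<close>.
\<close>

definition duality :: "('o, 'v) tcat \<Rightarrow> ('o \<Rightarrow> ('o, 'v) dual_data) \<Rightarrow> bool" where
  "duality C D \<longleftrightarrow> (\<forall>Y. is_left_dual C Y (D Y))"

definition ddual_obj :: "('o \<Rightarrow> ('o, 'v) dual_data) \<Rightarrow> 'o \<Rightarrow> 'o" where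
  "ddual_obj D Y = dobj (D (dobj (D Y)))"

definition ddual_mor ::
    "('o, 'v) tcat \<Rightarrow> ('o \<Rightarrow> ('o, 'v) dual_data) \<Rightarrow> 'o \<Rightarrow> 'o \<Rightarrow> 'v \<Rightarrow> 'v" where
  "ddual_mor C D Y Z f =
     dual_mor C (D (dobj (D Z))) (D (dobj (D Y))) (dual_mor C (D Y) (D Z) f)"

definition quasi_pivotal ::
    "('o, 'v) tcat \<Rightarrow> ('o \<Rightarrow> ('o, 'v) dual_data) \<Rightarrow> ('o \<Rightarrow> 'v) \<Rightarrow> bool" where
  "quasi_pivotal C D \<phi> \<longleftrightarrow>
     (\<forall>Y. iso_in C Y (ddual_obj D Y) (\<phi> Y)) \<and>
     (\<forall>Y Z. \<forall>f\<in>Hom C Y Z. ddual_mor C D Y Z f \<cdot>\<^bsub>C\<^esub> \<phi> Y = \<phi> Z \<cdot>\<^bsub>C\<^esub> f)"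

definition scalar_of :: "('o, 'v) tcat \<Rightarrow> 'v \<Rightarrow> complex" where
  "scalar_of C f = (THE c. f = scl C c (idm C (unit C)))"

definition tr :: "('o, 'v) tcat \<Rightarrow> ('o \<Rightarrow> ('o, 'v) dual_data) \<Rightarrow> 'o \<Rightarrow> 'v \<Rightarrow> complex" where
  "tr C D Y \<alpha> = scalar_of C
     (dev (D (dobj (D Y))) \<cdot>\<^bsub>C\<^esub> (\<alpha> \<boxtimes>\<^bsub>C\<^esub> idm C (dobj (D Y))) \<cdot>\<^bsub>C\<^esub> dcoev (D Y))"

definition weakly_positive ::
    "('o, 'v::ab_group_add) tcat \<Rightarrow> ('o \<Rightarrow> ('o, 'v) dual_data) \<Rightarrow> ('o \<Rightarrow> 'v) \<Rightarrow> bool" where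
  "weakly_positive C D \<phi> \<longleftrightarrow> quasi_pivotal C D \<phi> \<and>
     (\<forall>Y. \<not> zero_object C Y \<longrightarrow> (\<exists>r::real. r > 0 \<and> tr C D Y (\<phi> Y) = of_real r))"


section \<open>Frobenius algebras\<close>

record ('o, 'v) frob =
  fobj :: 'o
  fmul :: 'v
  fcomul :: 'v
  funit :: 'v
  fcounit :: 'v

definition algebra_in :: "('o, 'v) tcat \<Rightarrow> 'o \<Rightarrow> 'v \<Rightarrow> 'v \<Rightarrow> bool" where
  "algebra_in C X m e \<longleftrightarrow>
     m \<in> Hom C (X \<boxdot>\<^bsub>C\<^esub> X) X \<and> e \<in> Hom C (unit C) X \<and>
     m \<cdot>\<^bsub>C\<^esub> (m \<boxtimes>\<^bsub>C\<^esub> idm C X) = m \<cdot>\<^bsub>C\<^esub> (idm C X \<boxtimes>\<^bsub>C\<^esub> m) \<and>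
     m \<cdot>\<^bsub>C\<^esub> (e \<boxtimes>\<^bsub>C\<^esub> idm C X) = idm C X \<and>
     m \<cdot>\<^bsub>C\<^esub> (idm C X \<boxtimes>\<^bsub>C\<^esub> e) = idm C X"

definition coalgebra_in :: "('o, 'v) tcat \<Rightarrow> 'o \<Rightarrow> 'v \<Rightarrow> 'v \<Rightarrow> bool" where
  "coalgebra_in C X \<delta> \<epsilon> \<longleftrightarrow>
     \<delta> \<in> Hom C X (X \<boxdot>\<^bsub>C\<^esub> X) \<and> \<epsilon> \<in> Hom C X (unit C) \<and>
     (\<delta> \<boxtimes>\<^bsub>C\<^esub> idm C X) \<cdot>\<^bsub>C\<^esub> \<delta> = (idm C X \<boxtimes>\<^bsub>C\<^esub> \<delta>) \<cdot>\<^bsub>C\<^esub> \<delta> \<and>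
     (\<epsilon> \<boxtimes>\<^bsub>C\<^esub> idm C X) \<cdot>\<^bsub>C\<^esub> \<delta> = idm C X \<and>
     (idm C X \<boxtimes>\<^bsub>C\<^esub> \<epsilon>) \<cdot>\<^bsub>C\<^esub> \<delta> = idm C X"

definition frobenius_algebra :: "('o, 'v) tcat \<Rightarrow> ('o, 'v) frob \<Rightarrow> bool" where
  "frobenius_algebra C X \<longleftrightarrow>
     algebra_in C (fobj X) (fmul X) (funit X) \<and>
     coalgebra_in C (fobj X) (fcomul X) (fcounit X) \<and>
     (idm C (fobj X) \<boxtimes>\<^bsub>C\<^esub> fmul X) \<cdot>\<^bsub>C\<^esub> (fcomul X \<boxtimes>\<^bsub>C\<^esub> idm C (fobj X)) = fcomul X \<cdot>\<^bsub>C\<^esub> fmul X \<and>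
     fcomul X \<cdot>\<^bsub>C\<^esub> fmul X = (fmul X \<boxtimes>\<^bsub>C\<^esub> idm C (fobj X)) \<cdot>\<^bsub>C\<^esub> (idm C (fobj X) \<boxtimes>\<^bsub>C\<^esub> fcomul X)"

text \<open>The selfduality \<open>X\<^sup>* = X\<close> with which every Frobenius algebra is equipped.\<close>

definition frob_dual :: "('o, 'v) tcat \<Rightarrow> ('o, 'v) frob \<Rightarrow> ('o, 'v) dual_data" where
  "frob_dual C X = \<lparr>dobj = fobj X, dev = fcounit X \<cdot>\<^bsub>C\<^esub> fmul X, dcoev = fcomul X \<cdot>\<^bsub>C\<^esub> funit X\<rparr>"

definition connected_frob :: "('o, 'v::ab_group_add) tcat \<Rightarrow> ('o, 'v) frob \<Rightarrow> bool" where
  "connected_frob C X \<longleftrightarrow> vector_space.dim (scl C) (Hom C (unit C) (fobj X)) = 1"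


subsection \<open>Frobenius subalgebras\<close>

text \<open>For \<open>i : A \<rightarrow> X\<close>, the dual \<open>i\<^sup>* : X \<rightarrow> A\<close> with respect to the Frobenius selfdualities.\<close>

definition frob_star :: "('o, 'v) tcat \<Rightarrow> ('o, 'v) frob \<Rightarrow> ('o, 'v) frob \<Rightarrow> 'v \<Rightarrow> 'v" where
  "frob_star C A X i = dual_mor C (frob_dual C A) (frob_dual C X) i"

definition frobenius_subalgebra ::
    "('o, 'v) tcat \<Rightarrow> ('o, 'v) frob \<Rightarrow> ('o, 'v) frob \<Rightarrow> 'v \<Rightarrow> bool" where
  "frobenius_subalgebra C X A i \<longleftrightarrow> frobenius_algebra C A \<and>
     mono_in C (fobj A) (fobj X) i \<and>
     fmul X \<cdot>\<^bsub>C\<^esub> (i \<boxtimes>\<^bsub>C\<^esub> i) = i \<cdot>\<^bsub>C\<^esub> fmul A \<and> i \<cdot>\<^bsub>C\<^esub> funit A = funit X \<and>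
     frob_star C X A (frob_star C A X i) = i \<and>
     frob_star C A X i \<cdot>\<^bsub>C\<^esub> i = idm C (fobj A)"

definition frob_idem :: "('o, 'v) tcat \<Rightarrow> ('o, 'v) frob \<Rightarrow> ('o, 'v) frob \<Rightarrow> 'v \<Rightarrow> 'v" where
  "frob_idem C X A i = i \<cdot>\<^bsub>C\<^esub> frob_star C A X i"

definition frob_subs :: "('o, 'v) tcat \<Rightarrow> ('o, 'v) frob \<Rightarrow> (('o, 'v) frob \<times> 'v) set" where
  "frob_subs C X = {(A, i). frobenius_subalgebra C X A i}"

definition frob_equiv ::
    "('o, 'v) tcat \<Rightarrow> ('o, 'v) frob \<Rightarrow> ((('o, 'v) frob \<times> 'v) \<times> (('o, 'v) frob \<times> 'v)) set" where
  "frob_equiv C X = {((A, i), (B, j)). (A, i) \<in> frob_subs C X \<and> (B, j) \<in> frob_subs C X \<and>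
     frob_idem C X A i = frob_idem C X B j}"

abbreviation frob_class ::
    "('o, 'v) tcat \<Rightarrow> ('o, 'v) frob \<Rightarrow> ('o, 'v) frob \<Rightarrow> 'v \<Rightarrow> (('o, 'v) frob \<times> 'v) set" where
  "frob_class C X A i \<equiv> frob_equiv C X `` {(A, i)}"

definition frob_poset :: "('o, 'v) tcat \<Rightarrow> ('o, 'v) frob \<Rightarrow> (('o, 'v) frob \<times> 'v) set gorder" where
  "frob_poset C X =
     \<lparr>carrier = frob_subs C X // frob_equiv C X, eq = (=),
      le = (\<lambda>K K'. \<exists>(A, i)\<in>K. \<exists>(B, j)\<in>K'.
         frob_idem C X A i \<cdot>\<^bsub>C\<^esub> frob_idem C X B j = frob_idem C X A i \<and>
         frob_idem C X B j \<cdot>\<^bsub>C\<^esub> frob_idem C X A i = frob_idem C X A i)\<rparr>"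


section \<open>Coherent sublattices\<close>

text \<open>
  Let \<open>d\<close> be a selfduality of \<open>X\<close> (that is, \<open>dobj d = X\<close>).  The ambient dual of a split subobject
  \<open>(B, i, p)\<close> of \<open>X\<close> is given by a splitting \<open>(B', i', p')\<close> of \<open>(i \<cdot> p)\<^sup>*\<close>, with evaluation
  \<open>dev d \<cdot> (i' \<boxtimes> i)\<close> and coevaluation \<open>(p \<boxtimes> p') \<cdot> dcoev d\<close>.  Ambient selfduality means that one may take
  \<open>(B', i', p') = (B, i, p)\<close>.  A retraction \<open>p\<close> with this property is unique if it exists
  (if \<open>b = i \<cdot> p\<close> and \<open>c = i \<cdot> q\<close> are both fixed by the star then \<open>c = b \<cdot> c\<close> and dually \<open>c = c \<cdot> b = b\<close>);
  hence ambient selfduality of a subobject given only by a mono \<open>i\<close> quantifies over \<open>p\<close>.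
\<close>

definition splitting :: "('o, 'v) tcat \<Rightarrow> 'o \<Rightarrow> 'v \<Rightarrow> 'o \<Rightarrow> 'v \<Rightarrow> 'v \<Rightarrow> bool" where
  "splitting C X b B i p \<longleftrightarrow> i \<in> Hom C B X \<and> p \<in> Hom C X B \<and>
     p \<cdot>\<^bsub>C\<^esub> i = idm C B \<and> i \<cdot>\<^bsub>C\<^esub> p = b"

definition ambiently_selfdual ::
    "('o, 'v) tcat \<Rightarrow> ('o, 'v) dual_data \<Rightarrow> 'o \<Rightarrow> 'v \<Rightarrow> bool" where
  "ambiently_selfdual C d B i \<longleftrightarrow>
     (\<exists>p. splitting C (dobj d) (i \<cdot>\<^bsub>C\<^esub> p) B i p \<and>
          splitting C (dobj d) (dual_mor C d d (i \<cdot>\<^bsub>C\<^esub> p)) B i p)"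

definition is_intersection ::
    "('o, 'v) tcat \<Rightarrow> 'o \<Rightarrow> 'o \<Rightarrow> 'v \<Rightarrow> 'o \<Rightarrow> 'v \<Rightarrow> 'o \<Rightarrow> 'v \<Rightarrow> bool" where
  "is_intersection C X A i B j P k \<longleftrightarrow>
     (\<exists>a\<in>Hom C P A. \<exists>b\<in>Hom C P B. i \<cdot>\<^bsub>C\<^esub> a = k \<and> j \<cdot>\<^bsub>C\<^esub> b = k \<and>
        (\<forall>W. \<forall>f\<in>Hom C W A. \<forall>g\<in>Hom C W B. i \<cdot>\<^bsub>C\<^esub> f = j \<cdot>\<^bsub>C\<^esub> g \<longrightarrow>
           (\<exists>!u\<in>Hom C W P. a \<cdot>\<^bsub>C\<^esub> u = f \<and> b \<cdot>\<^bsub>C\<^esub> u = g)))"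

definition sub_le :: "('o, 'v) tcat \<Rightarrow> 'o \<Rightarrow> 'v \<Rightarrow> 'o \<Rightarrow> 'v \<Rightarrow> bool" where
  "sub_le C A i B j \<longleftrightarrow> (\<exists>u\<in>Hom C A B. i = j \<cdot>\<^bsub>C\<^esub> u)"

definition is_subobject_join ::
    "('o, 'v) tcat \<Rightarrow> 'o \<Rightarrow> 'o \<Rightarrow> 'v \<Rightarrow> 'o \<Rightarrow> 'v \<Rightarrow> 'o \<Rightarrow> 'v \<Rightarrow> bool" where
  "is_subobject_join C X A i B j J k \<longleftrightarrow>
     mono_in C J X k \<and> sub_le C A i J k \<and> sub_le C B j J k \<and>
     (\<forall>J' k'. mono_in C J' X k' \<and> sub_le C A i J' k' \<and> sub_le C B j J' k' \<longrightarrow> sub_le C J k J' k')"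

definition coherent_pair ::
    "('o, 'v) tcat \<Rightarrow> ('o, 'v) dual_data \<Rightarrow> 'o \<Rightarrow> 'v \<Rightarrow> 'o \<Rightarrow> 'v \<Rightarrow> bool" where
  "coherent_pair C d A i B j \<longleftrightarrow>
     ambiently_selfdual C d A i \<and> ambiently_selfdual C d B j \<and>
     (\<exists>P k. is_intersection C (dobj d) A i B j P k \<and> ambiently_selfdual C d P k) \<and>
     (\<exists>J k. is_subobject_join C (dobj d) A i B j J k \<and> ambiently_selfdual C d J k)"

text \<open>
  A sublattice is a subset that is a lattice under the induced order; its join need not be the join
  in the whole poset, which is not a lattice in general.
\<close>

definition coherent_sublattice ::
    "('o, 'v) tcat \<Rightarrow> ('o, 'v) frob \<Rightarrow> (('o, 'v) frob \<times> 'v) set set \<Rightarrow> bool" where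
  "coherent_sublattice C X L \<longleftrightarrow>
     L \<subseteq> carrier (frob_poset C X) \<and>
     Lattice.lattice (frob_poset C X\<lparr>carrier := L\<rparr>) \<and>
     (\<exists>K. least (frob_poset C X\<lparr>carrier := L\<rparr>) K L) \<and>
     (\<forall>K\<in>L. \<forall>K'\<in>L. \<forall>(A, i)\<in>K. \<forall>(B, j)\<in>K'.
        coherent_pair C (frob_dual C X) (fobj A) i (fobj B) j \<and>
        (\<exists>P k. (P, k) \<in> frob_subs C X \<and>
           is_intersection C (fobj X) (fobj A) i (fobj B) j (fobj P) k \<and>
           K \<sqinter>\<^bsub>frob_poset C X\<lparr>carrier := L\<rparr>\<^esub> K' = frob_class C X P k))"


section \<open>Rigidity invariance\<close>

definition simple_reps :: "('o, 'v::ab_group_add) tcat \<Rightarrow> 'o set \<Rightarrow> bool" where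
  "simple_reps C R \<longleftrightarrow> (\<forall>S\<in>R. simple_object C S) \<and>
     (\<forall>S. simple_object C S \<longrightarrow> (\<exists>!T\<in>R. \<exists>f. iso_in C S T f))"

definition object_basis ::
    "('o, 'v::ab_group_add) tcat \<Rightarrow> 'o set \<Rightarrow> 'o \<Rightarrow> ('o \<Rightarrow> 'v set) \<Rightarrow> bool" where
  "object_basis C R X \<B> \<longleftrightarrow> simple_reps C R \<and>
     (\<forall>S\<in>R. \<not> module.dependent (scl C) (\<B> S) \<and> module.span (scl C) (\<B> S) = Hom C X S)"

text \<open>The Hermitian form, conjugate-linear in the second argument, for which \<open>E\<close> is orthonormal.\<close>

definition basis_form :: "('o, 'v::ab_group_add) tcat \<Rightarrow> 'v set \<Rightarrow> 'v \<Rightarrow> 'v \<Rightarrow> complex" where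
  "basis_form C E f g =
     (\<Sum>b\<in>E. module.representation (scl C) E f b * cnj (module.representation (scl C) E g b))"

definition kappa' ::
    "('o, 'v) tcat \<Rightarrow> ('o, 'v) dual_data \<Rightarrow> ('o, 'v) dual_data \<Rightarrow> 'v \<Rightarrow> 'v \<Rightarrow> complex" where
  "kappa' C dX dS f g = (THE c. (f \<boxtimes>\<^bsub>C\<^esub> g) \<cdot>\<^bsub>C\<^esub> dcoev dX = scl C c (dcoev dS))"

definition M' ::
    "('o, 'v::ab_group_add) tcat \<Rightarrow> 'v set \<Rightarrow> 'o \<Rightarrow> ('o, 'v) dual_data \<Rightarrow> 'o \<Rightarrow> ('o, 'v) dual_data
      \<Rightarrow> 'v \<Rightarrow> 'v" where
  "M' C E X dX S dS g =
     (THE h. h \<in> Hom C X S \<and> (\<forall>f\<in>Hom C X S. basis_form C E f h = kappa' C dX dS f g))"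

text \<open>
  \<open>(A, i, p)\<close> is a split subobject of \<open>X\<close>; \<open>dA\<close> and \<open>dX\<close> are the left duals used for \<open>A\<close> and \<open>X\<close>, and
  \<open>D S\<close> is the one used for \<open>S\<close>.
\<close>

definition rigid_invariant ::
    "('o, 'v::ab_group_add) tcat \<Rightarrow> ('o \<Rightarrow> ('o, 'v) dual_data) \<Rightarrow> 'o set \<Rightarrow> ('o \<Rightarrow> 'v set)
      \<Rightarrow> 'o \<Rightarrow> ('o, 'v) dual_data \<Rightarrow> 'o \<Rightarrow> ('o, 'v) dual_data \<Rightarrow> 'v \<Rightarrow> 'v \<Rightarrow> bool" where
  "rigid_invariant C D R \<B> X dX A dA i p \<longleftrightarrow>
     i \<in> Hom C A X \<and> p \<in> Hom C X A \<and> p \<cdot>\<^bsub>C\<^esub> i = idm C A \<and>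
     (\<forall>S\<in>R. M' C (\<B> S) X dX S (D S) `
               ((\<lambda>g. g \<cdot>\<^bsub>C\<^esub> dual_mor C dA dX i) ` Hom C (dobj dA) (dobj (D S)))
            = (\<lambda>h. h \<cdot>\<^bsub>C\<^esub> p) ` Hom C A S)"

definition frobenius_basis_subalgebra ::
    "('o, 'v::ab_group_add) tcat \<Rightarrow> ('o \<Rightarrow> ('o, 'v) dual_data) \<Rightarrow> 'o set \<Rightarrow> ('o \<Rightarrow> 'v set)
      \<Rightarrow> ('o, 'v) frob \<Rightarrow> ('o, 'v) frob \<Rightarrow> 'v \<Rightarrow> bool" where
  "frobenius_basis_subalgebra C D R \<B> X A i \<longleftrightarrow> frobenius_subalgebra C X A i \<and>
     rigid_invariant C D R \<B> (fobj X) (frob_dual C X) (fobj A) (frob_dual C A) i (frob_star C A X i)"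

definition frob_basis_lattice ::
    "('o, 'v::ab_group_add) tcat \<Rightarrow> ('o \<Rightarrow> ('o, 'v) dual_data) \<Rightarrow> 'o set \<Rightarrow> ('o \<Rightarrow> 'v set)
      \<Rightarrow> ('o, 'v) frob \<Rightarrow> (('o, 'v) frob \<times> 'v) set gorder" where
  "frob_basis_lattice C D R \<B> X =
     frob_poset C X\<lparr>carrier :=
       {frob_class C X A i | A i. frobenius_basis_subalgebra C D R \<B> X A i}\<rparr>"

end

theory Submission
  imports Defs "Jordan_Normal_Form.Determinant" "HOL-Library.Function_Algebras"
begin

text \<open>
  The whole poset of Frobenius subalgebras of \<open>X\<close> is finite, and both assertions are about subsets of
  it.  A class is given by its idempotent \<open>b = i \<cdot> i\<^sup>*\<close> in the finite-dimensional space
  \<open>E = Hom(X, X)\<close>, so the task is to bound the number of these idempotents.  They are rigid for the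
  same reason for which separable subalgebras of an algebra with trivial centralizer are rigid, and a
  determinant turns rigidity into a bound.

  \<^bold>\<open>Separability.\<close> As \<open>X\<close> is connected, every morphism \<open>1 \<rightarrow> X\<close> is a multiple of the unit.  Let
  \<open>c = \<delta> \<cdot> e\<close> be the Casimir element of \<open>X\<close>.  The morphism \<open>m \<cdot> (\<phi>\<^sub>X \<otimes> 1) \<cdot> c\<close> is a multiple \<open>s e\<close>,
  where \<open>s \<noteq> 0\<close> because \<open>tr(\<phi>\<^sub>X) \<noteq> 0\<close>; since \<open>\<phi>\<^sub>X\<close> is multiplicative and \<open>c\<close> is central, this forces
  \<open>s \<phi>\<^sub>X = s 1\<close>, hence \<open>\<phi>\<^sub>X = 1\<close> (\<open>pivotal_identity\<close>).  For a Frobenius subalgebra \<open>A\<close> with idempotent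
  \<open>b\<close>, the image of the Casimir element of \<open>A\<close> in \<open>X \<otimes> X\<close> is \<open>p = (b \<otimes> 1) \<cdot> c\<close>.  Again \<open>m \<cdot> p = \<lambda> e\<close>, and
  naturality of \<open>\<phi>\<close> together with \<open>\<phi>\<^sub>X = 1\<close> gives \<open>tr(\<phi>\<^sub>A) = \<lambda> \<epsilon>(e)\<close> (\<open>trace_of_subalgebra\<close>), so
  \<open>\<lambda> \<noteq> 0\<close>: up to a scalar, \<open>p\<close> is a separability idempotent of \<open>A\<close> (\<open>frobenius_subalgebra_separable\<close>).

  \<^bold>\<open>Rigidity.\<close> Write \<open>p = \<Sum> a\<^sub>k \<otimes> b\<^sub>k\<close> symbolically.  For \<open>x\<close> in \<open>E\<close> let \<open>u(x)\<close> be the scalar with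
  \<open>\<Sum> x(a\<^sub>k) b\<^sub>k = u(x) e\<close> and let \<open>K\<^sub>b(x)\<close> be the linear operator on \<open>E\<close> with
  \<open>K\<^sub>b(x)(d)(y) = u(x) d(y) - (1 - x)(\<Sum> x(b(y) a\<^sub>k) d(b\<^sub>k))\<close>.
  It is quadratic in \<open>x\<close>.  If \<open>x\<close> is the idempotent of another Frobenius subalgebra then \<open>K\<^sub>b(x)\<close> kills
  the defect \<open>d = (1 - x) b\<close> of the inclusion of the image of \<open>b\<close> in that of \<open>x\<close> (\<open>insertion_defect\<close>);
  to first order this says that \<open>d\<close> is an inner derivation, implemented by a multiple of the unit.  On the
  other hand, \<open>K\<^sub>b(b) = \<lambda> 1\<close> (\<open>insertion_self\<close>).

  \<^bold>\<open>Counting.\<close> Hence \<open>det K\<^sub>b\<close> is a polynomial on \<open>E\<close> of degree at most \<open>2 dim E\<close>, which does not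
  vanish at \<open>b\<close> and vanishes at every other idempotent \<open>x\<close> of the family unless \<open>b \<le> x\<close>.  Such
  polynomials are linearly independent, and they lie in a space of finite dimension
  (\<open>finite_if_operators_degenerate\<close>).
\<close>

section \<open>Separating points by determinants\<close>

text \<open>
  The functions \<open>g p\<close> are linearly independent, because their matrix of values on \<open>S\<close> is triangular
  for the order \<open>r\<close> with nonzero diagonal: a linear relation is contradicted at an \<open>r\<close>-minimal point
  of its support.  Their number is therefore at most the dimension of the span of the functions \<open>e k\<close>.
\<close>

lemma finite_if_triangular_functions:
  fixes g :: "'b \<Rightarrow> 'b \<Rightarrow> complex" and e :: "'k \<Rightarrow> 'b \<Rightarrow> complex"
  assumes I: "finite I"
    and comb: "\<And>p. p \<in> S \<Longrightarrow> \<exists>c. \<forall>x\<in>S. g p x = (\<Sum>k\<in>I. c k * e k x)"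
    and diag: "\<And>p. p \<in> S \<Longrightarrow> g p p \<noteq> 0"
    and tri: "\<And>p x. p \<in> S \<Longrightarrow> x \<in> S \<Longrightarrow> g p x \<noteq> 0 \<Longrightarrow> r p x"
    and trans: "\<And>x y z. x \<in> S \<Longrightarrow> y \<in> S \<Longrightarrow> z \<in> S \<Longrightarrow> r x y \<Longrightarrow> r y z \<Longrightarrow> r x z"
    and anti: "\<And>x y. x \<in> S \<Longrightarrow> y \<in> S \<Longrightarrow> r x y \<Longrightarrow> r y x \<Longrightarrow> x = y"
  shows "finite S"
proof -
  interpret fs: vector_space "\<lambda>(c::complex) (f::'b \<Rightarrow> complex) x. c * f x"
    by unfold_locales (auto simp: fun_eq_iff algebra_simps)
  have fs_sum: "(\<Sum>a\<in>F. h a) x = (\<Sum>a\<in>F. h a x)" for F :: "'c set" and h :: "'c \<Rightarrow> 'b \<Rightarrow> complex" and x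
    by (induction F rule: infinite_finite_induct) auto
  \<comment> \<open>The functions are cut off outside \<open>S\<close>, so that relations between their values on \<open>S\<close> become
    relations between functions.\<close>
  define G where "G p x = (if x \<in> S then g p x else 0)" for p x
  define E where "E k x = (if x \<in> S then e k x else 0)" for k x
  have inj: "inj_on G S"
  proof (rule inj_onI)
    fix p q assume p: "p \<in> S" and q: "q \<in> S" and eq: "G p = G q"
    have "g p q \<noteq> 0" "g q p \<noteq> 0"
      using fun_cong[OF eq, of p] fun_cong[OF eq, of q] p q diag by (auto simp: G_def)
    with p q show "p = q" using tri anti by blast
  qed
  have span: "G ` S \<subseteq> fs.span (E ` I)"
  proof (rule image_subsetI)
    fix p assume "p \<in> S"
    then obtain c where c: "\<forall>x\<in>S. g p x = (\<Sum>k\<in>I. c k * e k x)" using comb by blast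
    have "G p = (\<Sum>k\<in>I. (\<lambda>x. c k * E k x))"
      using c by (auto simp: fun_eq_iff fs_sum G_def E_def)
    also have "\<dots> \<in> fs.span (E ` I)"
      by (intro fs.span_sum fs.span_scale fs.span_base) auto
    finally show "G p \<in> fs.span (E ` I)" .
  qed
  have "fs.independent (G ` S)"
    unfolding fs.independent_explicit_finite_subsets
  proof (intro allI impI)
    fix F u assume F: "F \<subseteq> G ` S" "finite F" and eq: "(\<Sum>f\<in>F. (\<lambda>x. u f * f x)) = 0"
    obtain P where P: "P \<subseteq> S" "F = G ` P" "finite P"
      using F by (meson finite_subset_image)
    have injP: "inj_on G P" using inj P inj_on_subset by blast
    have eq': "(\<Sum>p\<in>P. u (G p) * g p x) = 0" if "x \<in> S" for x
    proof -
      have "(\<Sum>f\<in>F. u f * f x) = 0" using fun_cong[OF eq, of x] by (simp add: fs_sum)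
      then show ?thesis using that by (simp add: P(2) sum.reindex[OF injP] G_def)
    qed
    define N where "N = {p\<in>P. u (G p) \<noteq> 0}"
    have "N = {}"
    proof (rule ccontr)
      assume "N \<noteq> {}"
      have NS: "N \<subseteq> S" "finite N" using P by (auto simp: N_def)
      have "asymp_on N (\<lambda>x y. r x y \<and> x \<noteq> y)"
        by (rule asymp_onI) (use NS anti in blast)
      moreover have "transp_on N (\<lambda>x y. r x y \<and> x \<noteq> y)"
      proof (rule transp_onI)
        fix x y z assume "x \<in> N" "y \<in> N" "z \<in> N" and xy: "r x y \<and> x \<noteq> y" and yz: "r y z \<and> y \<noteq> z"
        then have S: "x \<in> S" "y \<in> S" "z \<in> S" using NS by auto
        have "r x z" using trans[OF S] xy yz by blast
        moreover have "x \<noteq> z" using anti[OF S(1,2)] xy yz by blast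
        ultimately show "r x z \<and> x \<noteq> z" ..
      qed
      ultimately have "\<exists>m\<in>N. \<forall>x\<in>N. x \<noteq> m \<longrightarrow> \<not> (r x m \<and> x \<noteq> m)"
        by (rule Finite_Set.bex_min_element[OF NS(2) _ _ \<open>N \<noteq> {}\<close>])
      then obtain m where m: "m \<in> N" "\<And>x. x \<in> N \<Longrightarrow> x \<noteq> m \<Longrightarrow> \<not> r x m" by blast
      have mS: "m \<in> S" using m NS by blast
      have "(\<Sum>p\<in>P. u (G p) * g p m) = (\<Sum>p\<in>{m}. u (G p) * g p m)"
      proof (rule sum.mono_neutral_right[OF P(3)])
        show "{m} \<subseteq> P" using m by (auto simp: N_def)
        show "\<forall>p\<in>P - {m}. u (G p) * g p m = 0"
          using m tri mS P by (auto simp: N_def)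
      qed
      with eq'[OF mS] m diag[OF mS] show False by (auto simp: N_def)
    qed
    then show "\<forall>f\<in>F. u f = 0" by (auto simp: N_def P)
  qed
  from fs.independent_span_bound[OF _ this span] I have "finite (G ` S)" by auto
  then show ?thesis using inj finite_imageD by blast
qed

text \<open>
  Expanding the determinant gives products of \<open>n\<close> of the functions \<open>e k\<close>.  What matters is that this
  finite family of products does not depend on the coefficients \<open>c\<close>.
\<close>

lemma det_in_finite_span:
  fixes c :: "nat \<Rightarrow> nat \<Rightarrow> 'k \<Rightarrow> complex"
  assumes "finite I"
  shows "\<exists>a. \<forall>x. det (mat n n (\<lambda>(i, j). \<Sum>k\<in>I. c i j k * e k x)) =
     (\<Sum>\<psi>\<in>{0..<n} \<rightarrow>\<^sub>E I. a \<psi> * (\<Prod>i = 0..<n. e (\<psi> i) x))"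
proof (intro exI allI)
  fix x
  let ?M = "mat n n (\<lambda>(i, j). \<Sum>k\<in>I. c i j k * e k x)"
  have "det ?M = (\<Sum>p\<in>{p. p permutes {0..<n}}. signof p * (\<Prod>i = 0..<n. ?M $$ (i, p i)))"
    by (rule det_def') simp
  also have "\<dots> = (\<Sum>p\<in>{p. p permutes {0..<n}}. signof p *
      (\<Sum>\<psi>\<in>{0..<n} \<rightarrow>\<^sub>E I. (\<Prod>i = 0..<n. c i (p i) (\<psi> i)) * (\<Prod>i = 0..<n. e (\<psi> i) x)))"
  proof (intro sum.cong refl arg_cong2[where f = "(*)"])
    fix p assume "p \<in> {p. p permutes {0..<n}}"
    then have p: "p i < n" if "i < n" for i using that permutes_in_image[of p "{0..<n}" i] by auto
    have "(\<Prod>i = 0..<n. ?M $$ (i, p i)) = (\<Prod>i = 0..<n. \<Sum>k\<in>I. c i (p i) k * e k x)"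
      using p by (intro prod.cong) auto
    also have "\<dots> = (\<Sum>\<psi>\<in>{0..<n} \<rightarrow>\<^sub>E I. \<Prod>i = 0..<n. c i (p i) (\<psi> i) * e (\<psi> i) x)"
      by (rule prod_sum_PiE) (use assms in auto)
    finally show "(\<Prod>i = 0..<n. ?M $$ (i, p i)) =
      (\<Sum>\<psi>\<in>{0..<n} \<rightarrow>\<^sub>E I. (\<Prod>i = 0..<n. c i (p i) (\<psi> i)) * (\<Prod>i = 0..<n. e (\<psi> i) x))"
      by (simp add: prod.distrib)
  qed
  also have "\<dots> = (\<Sum>\<psi>\<in>{0..<n} \<rightarrow>\<^sub>E I. (\<Sum>p\<in>{p. p permutes {0..<n}}. signof p *
      (\<Prod>i = 0..<n. c i (p i) (\<psi> i))) * (\<Prod>i = 0..<n. e (\<psi> i) x))"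
    by (simp add: sum_distrib_left sum_distrib_right mult.assoc sum.swap[of _ "{p. p permutes {0..<n}}"])
  finally show "det ?M = \<dots>" .
qed

text \<open>
  Composition and tensor product of morphisms are linear only on hom-spaces, which are subspaces of
  one ambient space; hence linearity relative to subspaces.
\<close>

definition lin_map :: "(complex \<Rightarrow> 'v \<Rightarrow> 'v) \<Rightarrow> 'v set \<Rightarrow> 'v set \<Rightarrow> ('v::ab_group_add \<Rightarrow> 'v) \<Rightarrow> bool" where
  "lin_map s V W f \<longleftrightarrow> (\<forall>x\<in>V. f x \<in> W) \<and> (\<forall>x\<in>V. \<forall>y\<in>V. f (x + y) = f x + f y) \<and>
     (\<forall>c. \<forall>x\<in>V. f (s c x) = s c (f x))"

lemma lin_map_sum:
  assumes "vector_space s" "module.subspace s V" "lin_map s V W f" "finite J" "\<And>j. j \<in> J \<Longrightarrow> h j \<in> V"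
  shows "f (\<Sum>j\<in>J. s (c j) (h j)) = (\<Sum>j\<in>J. s (c j) (f (h j)))"
proof -
  interpret vector_space s by fact
  have f0: "f 0 = 0"
  proof -
    have "f (s 0 0) = s 0 (f 0)" using assms(3) subspace_0[OF assms(2)] by (simp only: lin_map_def)
    then show ?thesis by simp
  qed
  show ?thesis using assms(4,5)
  proof (induction J)
    case (insert j J)
    have "(\<Sum>j\<in>J. s (c j) (h j)) \<in> V"
      using insert assms(2) by (intro subspace_sum subspace_scale) auto
    with insert assms(2,3) show ?case by (simp add: lin_map_def subspace_scale)
  qed (simp add: f0)
qed

text \<open>
  A quadratic family \<open>K p\<close> of operators that is invertible at \<open>p\<close> and singular at all points that are not
  above \<open>p\<close> separates these points from \<open>p\<close> by its determinant, a polynomial whose degree is bounded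
  independently of \<open>p\<close>.
\<close>

lemma finite_if_operators_degenerate:
  fixes s :: "complex \<Rightarrow> 'v::ab_group_add \<Rightarrow> 'v"
  assumes vs: "vector_space s" and B: "finite B" and V: "V = module.span s B"
    and SV: "S \<subseteq> V"
    and lin: "\<And>p x. p \<in> S \<Longrightarrow> x \<in> S \<Longrightarrow> lin_map s V V (K p x)"
    and quad: "\<And>p D. p \<in> S \<Longrightarrow> D \<in> V \<Longrightarrow> \<exists>L Q. lin_map s V V L \<and>
        (\<forall>y\<in>V. lin_map s V V (Q y)) \<and> (\<forall>z\<in>V. lin_map s V V (\<lambda>y. Q y z)) \<and>
        (\<forall>x\<in>S. K p x D = L x + Q x x)"
    and diag: "\<And>p. p \<in> S \<Longrightarrow> \<exists>l. l \<noteq> 0 \<and> (\<forall>D\<in>V. K p p D = s l D)"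
    and ker: "\<And>p x. p \<in> S \<Longrightarrow> x \<in> S \<Longrightarrow> \<not> r p x \<Longrightarrow> \<exists>D\<in>V. D \<noteq> 0 \<and> K p x D = 0"
    and trans: "\<And>x y z. x \<in> S \<Longrightarrow> y \<in> S \<Longrightarrow> z \<in> S \<Longrightarrow> r x y \<Longrightarrow> r y z \<Longrightarrow> r x z"
    and anti: "\<And>x y. x \<in> S \<Longrightarrow> y \<in> S \<Longrightarrow> r x y \<Longrightarrow> r y x \<Longrightarrow> x = y"
  shows "finite S"
proof -
  interpret vector_space s by fact
  obtain B' where B': "B' \<subseteq> B" "independent B'" "span B' = V"
    using maximal_independent_subset[of B] V span_mono span_minimal subspace_span
    by (metis subset_antisym)
  have finB': "finite B'" using B B' finite_subset by blast
  have subV: "subspace V" using B'(3) subspace_span by blast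
  obtain \<beta> where bij: "bij_betw \<beta> {0..<card B'} B'" using finB' ex_bij_betw_nat_finite by blast
  define n where "n = card B'"
  have bn: "bij_betw \<beta> {0..<n} B'" using bij n_def by simp
  have bB: "\<beta> j \<in> B'" if "j < n" for j using bn that by (auto simp: bij_betw_def)
  have bV: "v \<in> V" if "v \<in> B'" for v using that B'(3) span_base by blast
  let ?c = "representation B'"
  have repr: "v = (\<Sum>b\<in>B'. s (?c v b) b)" if "v \<in> V" for v
    using that sum_representation_eq[OF B'(2), of v B'] finB' B'(3) by auto
  have repr': "v = (\<Sum>j = 0..<n. s (?c v (\<beta> j)) (\<beta> j))" if "v \<in> V" for v
    using repr[OF that] sum.reindex_bij_betw[OF bn, of "\<lambda>b. s (?c v b) b"] by simp
  \<comment> \<open>The entries of the matrix \<open>M p x\<close> of \<open>K p x\<close> are combinations of the coordinates of \<open>x\<close> and of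
    products of two coordinates; \<open>I\<close> indexes these monomials.\<close>
  define I where "I = B' <+> (B' \<times> B')"
  define e where "e k x = (case k of Inl v \<Rightarrow> ?c x v | Inr (v, w) \<Rightarrow> ?c x v * ?c x w)" for k x
  define M where "M p x = mat n n (\<lambda>(i, j). ?c (K p x (\<beta> j)) (\<beta> i))" for p x
  have finI: "finite I" using finB' by (simp add: I_def)
  have ent: "\<exists>c. \<forall>x\<in>S. ?c (K p x D) w = (\<Sum>k\<in>I. c k * e k x)" if p: "p \<in> S" and D: "D \<in> V" for p D w
  proof -
    obtain L Q where L: "lin_map s V V L" and Q1: "\<And>y. y \<in> V \<Longrightarrow> lin_map s V V (Q y)"
      and Q2: "\<And>z. z \<in> V \<Longrightarrow> lin_map s V V (\<lambda>y. Q y z)"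
      and K: "\<And>x. x \<in> S \<Longrightarrow> K p x D = L x + Q x x" using quad[OF p D] by blast
    define c where "c k = (case k of Inl v \<Rightarrow> ?c (L v) w | Inr (v, v') \<Rightarrow> ?c (Q v v') w)" for k
    have "?c (K p x D) w = (\<Sum>k\<in>I. c k * e k x)" if x: "x \<in> S" for x
    proof -
      have xV: "x \<in> V" using SV x by blast
      have LV: "L v \<in> V" if "v \<in> V" for v using L that by (auto simp: lin_map_def)
      have QV: "Q v v' \<in> V" if "v \<in> V" "v' \<in> V" for v v' using Q1 that by (auto simp: lin_map_def)
      have L': "L x = (\<Sum>b\<in>B'. s (?c x b) (L b))"
        using lin_map_sum[OF vs subV L finB', where c = "?c x" and h = "\<lambda>b. b"] bV repr[OF xV] by simp
      have Qa: "Q x x = (\<Sum>b\<in>B'. s (?c x b) (Q b x))"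
        using lin_map_sum[OF vs subV Q2[OF xV] finB', where c = "?c x" and h = "\<lambda>b. b"] bV repr[OF xV] by simp
      have Qb: "Q b x = (\<Sum>b'\<in>B'. s (?c x b') (Q b b'))" if "b \<in> B'" for b
        using lin_map_sum[OF vs subV Q1[OF bV[OF that]] finB', where c = "?c x" and h = "\<lambda>b. b"] bV repr[OF xV] by simp
      have Q': "Q x x = (\<Sum>(b, b')\<in>B' \<times> B'. s (?c x b * ?c x b') (Q b b'))"
        using Qa Qb by (simp add: scale_sum_right sum.cartesian_product)
      have "?c (L x) w = (\<Sum>b\<in>B'. ?c (L b) w * ?c x b)"
        unfolding L' using LV bV
        by (subst representation_sum)
           (auto simp: B'(2,3) representation_scale subspace_scale[OF subV] mult.commute)
      moreover have "?c (Q x x) w = (\<Sum>z\<in>B' \<times> B'. ?c (Q (fst z) (snd z)) w * (?c x (fst z) * ?c x (snd z)))"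
        unfolding Q' using QV bV
        by (subst representation_sum)
           (auto simp: B'(2,3) representation_scale subspace_scale[OF subV] mult.commute case_prod_beta intro!: sum.cong)
      moreover have "?c (L x + Q x x) w = ?c (L x) w + ?c (Q x x) w"
        using LV QV xV by (subst representation_add) (auto simp: B'(2,3))
      ultimately have "?c (K p x D) w = (\<Sum>b\<in>B'. ?c (L b) w * ?c x b) +
          (\<Sum>z\<in>B' \<times> B'. ?c (Q (fst z) (snd z)) w * (?c x (fst z) * ?c x (snd z)))"
        by (simp only: K[OF x])
      also have "\<dots> = (\<Sum>k\<in>I. c k * e k x)"
        unfolding I_def using finB'
        by (subst sum.Plus) (simp_all add: c_def e_def case_prod_beta)
      finally show ?thesis .
    qed
    then show ?thesis by blast
  qed
  have span: "\<exists>a. \<forall>x\<in>S. det (M p x) = (\<Sum>\<psi>\<in>{0..<n} \<rightarrow>\<^sub>E I. a \<psi> * (\<Prod>i = 0..<n. e (\<psi> i) x))"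
    if p: "p \<in> S" for p
  proof -
    have "\<forall>i j. \<exists>c. j < n \<longrightarrow> (\<forall>x\<in>S. ?c (K p x (\<beta> j)) (\<beta> i) = (\<Sum>k\<in>I. c k * e k x))"
      using ent[OF p] bV bB by blast
    then obtain c where c: "\<And>i j x. j < n \<Longrightarrow> x \<in> S \<Longrightarrow>
        ?c (K p x (\<beta> j)) (\<beta> i) = (\<Sum>k\<in>I. c i j k * e k x)" by metis
    have M: "M p x = mat n n (\<lambda>(i, j). \<Sum>k\<in>I. c i j k * e k x)" if "x \<in> S" for x
      unfolding M_def using c that by (intro eq_matI) auto
    obtain a where "\<forall>x. det (mat n n (\<lambda>(i, j). \<Sum>k\<in>I. c i j k * e k x)) =
        (\<Sum>\<psi>\<in>{0..<n} \<rightarrow>\<^sub>E I. a \<psi> * (\<Prod>i = 0..<n. e (\<psi> i) x))"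
      using det_in_finite_span[OF finI, of n c e] by blast
    then have "\<forall>x\<in>S. det (M p x) = (\<Sum>\<psi>\<in>{0..<n} \<rightarrow>\<^sub>E I. a \<psi> * (\<Prod>i = 0..<n. e (\<psi> i) x))"
      by (simp add: M)
    then show ?thesis by blast
  qed
  have det_diag: "det (M p p) \<noteq> 0" if p: "p \<in> S" for p
  proof -
    obtain l where l: "l \<noteq> 0" "\<And>D. D \<in> V \<Longrightarrow> K p p D = s l D" using diag[OF p] by blast
    have "M p p = l \<cdot>\<^sub>m 1\<^sub>m n"
    proof (rule eq_matI)
      fix i j assume "i < dim_row (l \<cdot>\<^sub>m 1\<^sub>m n)" "j < dim_col (l \<cdot>\<^sub>m 1\<^sub>m n)"
      then have ij: "i < n" "j < n" by auto
      then have "\<beta> j = \<beta> i \<longleftrightarrow> i = j" using bn by (auto simp: bij_betw_def inj_on_def)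
      with ij show "M p p $$ (i, j) = (l \<cdot>\<^sub>m 1\<^sub>m n) $$ (i, j)"
        using l(2)[OF bV[OF bB[OF ij(2)]]] bB bV
        by (auto simp: B'(2,3) M_def representation_scale representation_basis)
    qed (auto simp: M_def)
    then show ?thesis using l by simp
  qed
  have det_off: "r p x" if p: "p \<in> S" and x: "x \<in> S" and nz: "det (M p x) \<noteq> 0" for p x
  proof (rule ccontr)
    assume "\<not> r p x"
    then obtain D where D: "D \<in> V" "D \<noteq> 0" "K p x D = 0" using ker[OF p x] by blast
    let ?v = "vec n (\<lambda>j. ?c D (\<beta> j))"
    have KV: "K p x v \<in> V" if "v \<in> V" for v using lin[OF p x] that by (auto simp: lin_map_def)
    have "?v \<noteq> 0\<^sub>v n"
    proof
      assume "?v = 0\<^sub>v n"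
      then have "?c D (\<beta> j) = 0" if "j < n" for j using that by (metis index_vec index_zero_vec(1))
      then show False using repr'[OF D(1)] D(2) by simp
    qed
    moreover have "M p x *\<^sub>v ?v = 0\<^sub>v n"
    proof (rule eq_vecI)
      fix i assume "i < dim_vec (0\<^sub>v n :: complex vec)"
      then have i: "i < n" by simp
      have "K p x (\<Sum>j = 0..<n. s (?c D (\<beta> j)) (\<beta> j)) = (\<Sum>j = 0..<n. s (?c D (\<beta> j)) (K p x (\<beta> j)))"
        using bB bV by (intro lin_map_sum[OF vs subV lin[OF p x]]) auto
      then have "0 = (\<Sum>j = 0..<n. s (?c D (\<beta> j)) (K p x (\<beta> j)))"
        using repr'[OF D(1)] D(3) by simp
      then have "0 = ?c (\<Sum>j = 0..<n. s (?c D (\<beta> j)) (K p x (\<beta> j))) (\<beta> i)"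
        by (metis representation_zero)
      also have "\<dots> = (\<Sum>j = 0..<n. ?c (K p x (\<beta> j)) (\<beta> i) * ?c D (\<beta> j))"
        using bB bV KV
        by (subst representation_sum) (auto simp: B'(2,3) representation_scale subspace_scale[OF subV] mult.commute)
      finally show "(M p x *\<^sub>v ?v) $ i = 0\<^sub>v n $ i"
        using i by (simp add: M_def scalar_prod_def)
    qed (simp add: M_def)
    moreover have "M p x \<in> carrier_mat n n" "?v \<in> carrier_vec n" by (simp_all add: M_def)
    ultimately have "det (M p x) = 0"
      using det_0_iff_vec_prod_zero by blast
    with nz show False ..
  qed
  have fin: "finite ({0..<n} \<rightarrow>\<^sub>E I)" using finI by (intro finite_PiE) auto
  show ?thesis
    by (rule finite_if_triangular_functions[OF fin, where g = "\<lambda>p x. det (M p x)" and r = r,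
          OF span det_diag det_off trans anti])
qed

lemma lin_map_comp:
  "lin_map s U V f \<Longrightarrow> lin_map s V W g \<Longrightarrow> lin_map s U W (\<lambda>x. g (f x))"
  by (simp add: lin_map_def)

section \<open>Morphisms with a domain and a codomain\<close>

text \<open>
  A vector may belong to several hom-spaces.  Recording domain and codomain with it makes the side
  conditions of the category laws decidable by rewriting, so that the simplifier can apply them.
\<close>

datatype ('o, 'v) arrow = Arrow (src: 'o) (tgt: 'o) (mor: 'v)

context linear_monoidal_category
begin

definition arr :: "('a, 'b) arrow \<Rightarrow> bool" where
  "arr f \<longleftrightarrow> mor f \<in> Hom C (src f) (tgt f)"

definition cmp :: "('a, 'b) arrow \<Rightarrow> ('a, 'b) arrow \<Rightarrow> ('a, 'b) arrow"  (infixr "\<circ>\<^sub>a" 70) where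
  "g \<circ>\<^sub>a f = Arrow (src f) (tgt g) (mor g \<cdot> mor f)"

definition tns :: "('a, 'b) arrow \<Rightarrow> ('a, 'b) arrow \<Rightarrow> ('a, 'b) arrow"  (infixr "\<otimes>\<^sub>a" 75) where
  "f \<otimes>\<^sub>a g = Arrow (src f \<boxdot> src g) (tgt f \<boxdot> tgt g) (mor f \<boxtimes> mor g)"

definition ida :: "'a \<Rightarrow> ('a, 'b) arrow" where
  "ida X = Arrow X X (idm C X)"

definition sca :: "complex \<Rightarrow> ('a, 'b) arrow \<Rightarrow> ('a, 'b) arrow" where
  "sca c f = Arrow (src f) (tgt f) (scl C c (mor f))"

lemma arrow_eqI: "src f = src g \<Longrightarrow> tgt f = tgt g \<Longrightarrow> mor f = mor g \<Longrightarrow> f = g"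
  by (rule arrow.expand) simp

lemma ends [simp]:
  "src (g \<circ>\<^sub>a f) = src f" "tgt (g \<circ>\<^sub>a f) = tgt g"
  "src (f \<otimes>\<^sub>a g) = src f \<boxdot> src g" "tgt (f \<otimes>\<^sub>a g) = tgt f \<boxdot> tgt g"
  "src (ida X) = X" "tgt (ida X) = X"
  "src (sca c f) = src f" "tgt (sca c f) = tgt f"
  by (simp_all add: cmp_def tns_def ida_def sca_def)

lemma mor_simps:
  "mor (g \<circ>\<^sub>a f) = mor g \<cdot> mor f" "mor (f \<otimes>\<^sub>a g) = mor f \<boxtimes> mor g"
  "mor (ida X) = idm C X" "mor (sca c f) = scl C c (mor f)"
  by (simp_all add: cmp_def tns_def ida_def sca_def)

lemma arrD: "arr f \<Longrightarrow> src f = X \<Longrightarrow> tgt f = Y \<Longrightarrow> mor f \<in> Hom C X Y"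
  by (simp add: arr_def)

lemma scl_zero: "scl C 0 v = 0" "scl C c 0 = 0"
proof -
  interpret vector_space "scl C" by (rule vector_space_scl)
  show "scl C 0 v = 0" "scl C c 0 = 0" by simp_all
qed

lemma subspaceD:
  "f \<in> Hom C X Y \<Longrightarrow> g \<in> Hom C X Y \<Longrightarrow> f + g \<in> Hom C X Y"
  "f \<in> Hom C X Y \<Longrightarrow> scl C c f \<in> Hom C X Y"
  "0 \<in> Hom C X Y"
  "f \<in> Hom C X Y \<Longrightarrow> g \<in> Hom C X Y \<Longrightarrow> f - g \<in> Hom C X Y"
proof -
  interpret vector_space "scl C" by (rule vector_space_scl)
  show "f \<in> Hom C X Y \<Longrightarrow> g \<in> Hom C X Y \<Longrightarrow> f + g \<in> Hom C X Y"
    "f \<in> Hom C X Y \<Longrightarrow> scl C c f \<in> Hom C X Y" "0 \<in> Hom C X Y"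
    "f \<in> Hom C X Y \<Longrightarrow> g \<in> Hom C X Y \<Longrightarrow> f - g \<in> Hom C X Y"
    using subspace_Hom subspace_add subspace_scale subspace_0 subspace_diff by blast+
qed

lemma arr_intros [simp]:
  "arr f \<Longrightarrow> arr g \<Longrightarrow> tgt f = src g \<Longrightarrow> arr (g \<circ>\<^sub>a f)"
  "arr f \<Longrightarrow> arr g \<Longrightarrow> arr (f \<otimes>\<^sub>a g)" "arr (ida X)" "arr f \<Longrightarrow> arr (sca c f)"
  by (auto simp: arr_def mor_simps intro: comp_Hom tmor_Hom idm_Hom subspaceD)

lemma cmp_assoc [simp]:
  "arr f \<Longrightarrow> arr g \<Longrightarrow> arr h \<Longrightarrow> tgt f = src g \<Longrightarrow> tgt g = src h \<Longrightarrow> (h \<circ>\<^sub>a g) \<circ>\<^sub>a f = h \<circ>\<^sub>a (g \<circ>\<^sub>a f)"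
  using comp_assoc[of "mor f" "src f" "tgt f" "mor g" "tgt g" "mor h" "tgt h"]
  by (auto simp: arr_def cmp_def)

lemma cmp_ida [simp]:
  "arr f \<Longrightarrow> tgt f = Y \<Longrightarrow> ida Y \<circ>\<^sub>a f = f" "arr f \<Longrightarrow> src f = X \<Longrightarrow> f \<circ>\<^sub>a ida X = f"
  by (cases f; auto simp: arr_def cmp_def ida_def intro: comp_idm_left comp_idm_right)+

lemmas tobj_simps [simp] = tobj_assoc tobj_unit_left tobj_unit_right

lemma tns_assoc [simp]:
  "arr f \<Longrightarrow> arr g \<Longrightarrow> arr h \<Longrightarrow> (f \<otimes>\<^sub>a g) \<otimes>\<^sub>a h = f \<otimes>\<^sub>a (g \<otimes>\<^sub>a h)"
  using tmor_assoc[of "mor f" "src f" "tgt f" "mor g" "src g" "tgt g" "mor h" "src h" "tgt h"]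
  by (auto simp: arr_def tns_def)

lemma tns_unit [simp]:
  "arr f \<Longrightarrow> ida (unit C) \<otimes>\<^sub>a f = f" "arr f \<Longrightarrow> f \<otimes>\<^sub>a ida (unit C) = f"
  by (cases f; auto simp: arr_def tns_def ida_def intro: tmor_unit_left tmor_unit_right)+

lemma tns_ida: "ida X \<otimes>\<^sub>a ida Y = ida (X \<boxdot> Y)"
  by (simp add: tns_def ida_def tmor_idm)

lemma cmp_ida_tns [simp]:
  "arr f \<Longrightarrow> tgt f = X \<boxdot> Y \<Longrightarrow> (ida X \<otimes>\<^sub>a ida Y) \<circ>\<^sub>a f = f"
  "arr f \<Longrightarrow> src f = X \<boxdot> Y \<Longrightarrow> f \<circ>\<^sub>a (ida X \<otimes>\<^sub>a ida Y) = f"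
  by (simp_all add: tns_ida)

lemma interchange:
  "arr f \<Longrightarrow> arr f' \<Longrightarrow> arr g \<Longrightarrow> arr g' \<Longrightarrow> tgt f = src f' \<Longrightarrow> tgt g = src g' \<Longrightarrow>
    (f' \<otimes>\<^sub>a g') \<circ>\<^sub>a (f \<otimes>\<^sub>a g) = (f' \<circ>\<^sub>a f) \<otimes>\<^sub>a (g' \<circ>\<^sub>a g)"
  using tmor_comp[of "mor f" "src f" "tgt f" "mor f'" "tgt f'" "mor g" "src g" "tgt g" "mor g'" "tgt g'"]
  by (auto simp: arr_def tns_def cmp_def)

lemma interchange':
  "arr f \<Longrightarrow> arr f' \<Longrightarrow> arr g \<Longrightarrow> arr g' \<Longrightarrow> tgt f = src f' \<Longrightarrow> tgt g = src g' \<Longrightarrow>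
    arr h \<Longrightarrow> tgt h = src f \<boxdot> src g \<Longrightarrow>
    (f' \<otimes>\<^sub>a g') \<circ>\<^sub>a (f \<otimes>\<^sub>a g) \<circ>\<^sub>a h = ((f' \<circ>\<^sub>a f) \<otimes>\<^sub>a (g' \<circ>\<^sub>a g)) \<circ>\<^sub>a h"
  by (subst interchange[symmetric]) simp_all

lemma sca_simps:
  "arr f \<Longrightarrow> arr g \<Longrightarrow> tgt f = src g \<Longrightarrow> sca c g \<circ>\<^sub>a f = sca c (g \<circ>\<^sub>a f)"
  "arr f \<Longrightarrow> arr g \<Longrightarrow> tgt f = src g \<Longrightarrow> g \<circ>\<^sub>a sca c f = sca c (g \<circ>\<^sub>a f)"
  "arr f \<Longrightarrow> arr g \<Longrightarrow> sca c f \<otimes>\<^sub>a g = sca c (f \<otimes>\<^sub>a g)"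
  "arr f \<Longrightarrow> arr g \<Longrightarrow> f \<otimes>\<^sub>a sca c g = sca c (f \<otimes>\<^sub>a g)"
  using comp_scl_left[of "mor f" "src f" "tgt f" "mor g" "tgt g"]
    comp_scl_right[of "mor f" "src f" "tgt f" "mor g" "tgt g"]
    tmor_scl_left[of "mor f" "src f" "tgt f" "mor g" "src g" "tgt g"]
    tmor_scl_right[of "mor f" "src f" "tgt f" "mor g" "src g" "tgt g"]
  by (auto simp: arr_def tns_def cmp_def sca_def)

lemma tns_split:
  assumes "arr f" "arr g"
  shows tns_split_left: "f \<otimes>\<^sub>a g = (f \<otimes>\<^sub>a ida (tgt g)) \<circ>\<^sub>a (ida (src f) \<otimes>\<^sub>a g)"
    and tns_split_right: "f \<otimes>\<^sub>a g = (ida (tgt f) \<otimes>\<^sub>a g) \<circ>\<^sub>a (f \<otimes>\<^sub>a ida (src g))"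
  using assms by (simp_all add: interchange)

lemma whisker:
  assumes "arr f" "arr g" "tgt f = src g"
  shows "(g \<circ>\<^sub>a f) \<otimes>\<^sub>a ida X = (g \<otimes>\<^sub>a ida X) \<circ>\<^sub>a (f \<otimes>\<^sub>a ida X)"
    and "ida X \<otimes>\<^sub>a (g \<circ>\<^sub>a f) = (ida X \<otimes>\<^sub>a g) \<circ>\<^sub>a (ida X \<otimes>\<^sub>a f)"
  using assms by (simp_all add: interchange)

definition dif :: "('a, 'b) arrow \<Rightarrow> ('a, 'b) arrow \<Rightarrow> ('a, 'b) arrow"  (infixl "\<ominus>\<^sub>a" 65) where
  "f \<ominus>\<^sub>a g = Arrow (src f) (tgt f) (mor f - mor g)"

lemma dif_ends [simp]: "src (f \<ominus>\<^sub>a g) = src f" "tgt (f \<ominus>\<^sub>a g) = tgt f"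
  and mor_dif: "mor (f \<ominus>\<^sub>a g) = mor f - mor g"
  by (simp_all add: dif_def)

lemma arr_dif [simp]: "arr f \<Longrightarrow> arr g \<Longrightarrow> src f = src g \<Longrightarrow> tgt f = tgt g \<Longrightarrow> arr (f \<ominus>\<^sub>a g)"
  by (auto simp: arr_def mor_dif intro: subspaceD)

lemma dif_simps:
  "arr f \<Longrightarrow> arr g \<Longrightarrow> arr h \<Longrightarrow> src f = src g \<Longrightarrow> tgt f = tgt g \<Longrightarrow> tgt h = src f \<Longrightarrow>
    (f \<ominus>\<^sub>a g) \<circ>\<^sub>a h = f \<circ>\<^sub>a h \<ominus>\<^sub>a g \<circ>\<^sub>a h"
  "arr f \<Longrightarrow> arr g \<Longrightarrow> arr h \<Longrightarrow> src f = src g \<Longrightarrow> tgt f = tgt g \<Longrightarrow> tgt f = src h \<Longrightarrow>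
    h \<circ>\<^sub>a (f \<ominus>\<^sub>a g) = h \<circ>\<^sub>a f \<ominus>\<^sub>a h \<circ>\<^sub>a g"
  "arr f \<Longrightarrow> arr g \<Longrightarrow> arr h \<Longrightarrow> src f = src g \<Longrightarrow> tgt f = tgt g \<Longrightarrow>
    h \<otimes>\<^sub>a (f \<ominus>\<^sub>a g) = h \<otimes>\<^sub>a f \<ominus>\<^sub>a h \<otimes>\<^sub>a g"
proof -
  have diff: "F (x - y) = F x - F y" if "\<And>a b. a \<in> V \<Longrightarrow> b \<in> V \<Longrightarrow> F (a + b) = F a + F b"
    "x - y \<in> V" "y \<in> V" for F :: "'b \<Rightarrow> 'b" and x y V
    using that(1)[OF that(2,3)] by simp
  show "arr f \<Longrightarrow> arr g \<Longrightarrow> arr h \<Longrightarrow> src f = src g \<Longrightarrow> tgt f = tgt g \<Longrightarrow> tgt h = src f \<Longrightarrow>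
    (f \<ominus>\<^sub>a g) \<circ>\<^sub>a h = f \<circ>\<^sub>a h \<ominus>\<^sub>a g \<circ>\<^sub>a h"
    using diff[of "Hom C (src f) (tgt f)" "\<lambda>a. a \<cdot> mor h" "mor f" "mor g"]
    by (auto simp: arr_def cmp_def dif_def subspaceD intro!: comp_add_left)
  show "arr f \<Longrightarrow> arr g \<Longrightarrow> arr h \<Longrightarrow> src f = src g \<Longrightarrow> tgt f = tgt g \<Longrightarrow> tgt f = src h \<Longrightarrow>
    h \<circ>\<^sub>a (f \<ominus>\<^sub>a g) = h \<circ>\<^sub>a f \<ominus>\<^sub>a h \<circ>\<^sub>a g"
    using diff[of "Hom C (src f) (tgt f)" "\<lambda>a. mor h \<cdot> a" "mor f" "mor g"]
    by (auto simp: arr_def cmp_def dif_def subspaceD intro!: comp_add_right)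
  show "arr f \<Longrightarrow> arr g \<Longrightarrow> arr h \<Longrightarrow> src f = src g \<Longrightarrow> tgt f = tgt g \<Longrightarrow>
    h \<otimes>\<^sub>a (f \<ominus>\<^sub>a g) = h \<otimes>\<^sub>a f \<ominus>\<^sub>a h \<otimes>\<^sub>a g"
    using diff[of "Hom C (src f) (tgt f)" "\<lambda>a. mor h \<boxtimes> a" "mor f" "mor g"]
    by (auto simp: arr_def tns_def dif_def subspaceD intro!: tmor_add_right)
qed

section \<open>Dual morphisms\<close>

definition eva :: "'a \<Rightarrow> ('a, 'b) dual_data \<Rightarrow> ('a, 'b) arrow" where
  "eva X d = Arrow (dobj d \<boxdot> X) (unit C) (dev d)"

definition coeva :: "'a \<Rightarrow> ('a, 'b) dual_data \<Rightarrow> ('a, 'b) arrow" where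
  "coeva X d = Arrow (unit C) (X \<boxdot> dobj d) (dcoev d)"

definition duala :: "('a, 'b) dual_data \<Rightarrow> ('a, 'b) dual_data \<Rightarrow> ('a, 'b) arrow \<Rightarrow> ('a, 'b) arrow" where
  "duala dX dY f = Arrow (dobj dY) (dobj dX) (dual_mor C dX dY (mor f))"

lemma dual_ends [simp]:
  "src (eva X d) = dobj d \<boxdot> X" "tgt (eva X d) = unit C"
  "src (coeva X d) = unit C" "tgt (coeva X d) = X \<boxdot> dobj d"
  "src (duala d d' f) = dobj d'" "tgt (duala d d' f) = dobj d"
  by (simp_all add: eva_def coeva_def duala_def)

lemma left_dual_arr:
  assumes "is_left_dual C X d"
  shows "arr (eva X d)" "arr (coeva X d)"
    and "(ida X \<otimes>\<^sub>a eva X d) \<circ>\<^sub>a (coeva X d \<otimes>\<^sub>a ida X) = ida X"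
    and "(eva X d \<otimes>\<^sub>a ida (dobj d)) \<circ>\<^sub>a (ida (dobj d) \<otimes>\<^sub>a coeva X d) = ida (dobj d)"
  using assms by (auto simp: is_left_dual_def arr_def eva_def coeva_def cmp_def tns_def ida_def)

lemma duala_eq:
  assumes "is_left_dual C (src f) dX" "is_left_dual C (tgt f) dY" "arr f"
  shows "duala dX dY f = (eva (tgt f) dY \<otimes>\<^sub>a ida (dobj dX)) \<circ>\<^sub>a
     (ida (dobj dY) \<otimes>\<^sub>a f \<otimes>\<^sub>a ida (dobj dX)) \<circ>\<^sub>a (ida (dobj dY) \<otimes>\<^sub>a coeva (src f) dX)"
proof -
  note [simp] = left_dual_arr[OF assms(1)] left_dual_arr[OF assms(2)] assms(3)
  have "duala dX dY f = ((eva (tgt f) dY \<otimes>\<^sub>a ida (dobj dX)) \<circ>\<^sub>a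
     (ida (dobj dY) \<otimes>\<^sub>a f \<otimes>\<^sub>a ida (dobj dX))) \<circ>\<^sub>a (ida (dobj dY) \<otimes>\<^sub>a coeva (src f) dX)"
    by (simp add: duala_def dual_mor_def cmp_def tns_def ida_def eva_def coeva_def)
  also have "\<dots> = (eva (tgt f) dY \<otimes>\<^sub>a ida (dobj dX)) \<circ>\<^sub>a
     (ida (dobj dY) \<otimes>\<^sub>a f \<otimes>\<^sub>a ida (dobj dX)) \<circ>\<^sub>a (ida (dobj dY) \<otimes>\<^sub>a coeva (src f) dX)"
    by (rule cmp_assoc) simp_all
  finally show ?thesis .
qed

lemma arr_duala [simp]:
  assumes "is_left_dual C (src f) dX" "is_left_dual C (tgt f) dY" "arr f"
  shows "arr (duala dX dY f)"
  using assms by (simp add: duala_eq left_dual_arr)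

text \<open>
  A morphism can be moved through an evaluation or a coevaluation at the price of dualizing it; this
  property characterizes the dual morphism, and it is the form in which duals are used from here on.
\<close>

lemma duala_ev:
  assumes "is_left_dual C (src f) dX" "is_left_dual C (tgt f) dY" "arr f"
  shows "eva (src f) dX \<circ>\<^sub>a (duala dX dY f \<otimes>\<^sub>a ida (src f)) =
    eva (tgt f) dY \<circ>\<^sub>a (ida (dobj dY) \<otimes>\<^sub>a f)"
proof -
  note [simp] = left_dual_arr(1,2)[OF assms(1)] left_dual_arr(1,2)[OF assms(2)] assms(3)
  let ?X = "src f" and ?Y = "tgt f" and ?x = "dobj dX" and ?y = "dobj dY"
  have "eva ?X dX \<circ>\<^sub>a (duala dX dY f \<otimes>\<^sub>a ida ?X) = eva ?X dX \<circ>\<^sub>a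
      (eva ?Y dY \<otimes>\<^sub>a ida (?x \<boxdot> ?X)) \<circ>\<^sub>a (ida ?y \<otimes>\<^sub>a f \<otimes>\<^sub>a ida (?x \<boxdot> ?X)) \<circ>\<^sub>a (ida ?y \<otimes>\<^sub>a coeva ?X dX \<otimes>\<^sub>a ida ?X)"
    using assms by (simp add: duala_eq whisker tns_ida)
  also have "\<dots> = (eva ?Y dY \<circ>\<^sub>a (ida (?y \<boxdot> ?Y) \<otimes>\<^sub>a eva ?X dX)) \<circ>\<^sub>a
     (ida ?y \<otimes>\<^sub>a f \<otimes>\<^sub>a ida (?x \<boxdot> ?X)) \<circ>\<^sub>a (ida ?y \<otimes>\<^sub>a coeva ?X dX \<otimes>\<^sub>a ida ?X)"
  proof -
    have "eva ?X dX \<circ>\<^sub>a (eva ?Y dY \<otimes>\<^sub>a ida (?x \<boxdot> ?X)) = eva ?Y dY \<circ>\<^sub>a (ida (?y \<boxdot> ?Y) \<otimes>\<^sub>a eva ?X dX)"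
      using tns_split[of "eva ?Y dY" "eva ?X dX"] by simp
    then show ?thesis
      by (simp flip: cmp_assoc add: interchange)
  qed
  also have "\<dots> = eva ?Y dY \<circ>\<^sub>a (ida ?y \<otimes>\<^sub>a f) \<circ>\<^sub>a
      (ida ?y \<otimes>\<^sub>a ((ida ?X \<otimes>\<^sub>a eva ?X dX) \<circ>\<^sub>a (coeva ?X dX \<otimes>\<^sub>a ida ?X)))"
    using tns_split_left[of f "eva ?X dX"] by (simp add: interchange interchange' flip: tns_ida)
  also have "\<dots> = eva ?Y dY \<circ>\<^sub>a (ida ?y \<otimes>\<^sub>a f)"
    by (simp add: left_dual_arr[OF assms(1)] tns_ida)
  finally show ?thesis .
qed

lemma duala_coev:
  assumes "is_left_dual C (src f) dX" "is_left_dual C (tgt f) dY" "arr f"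
  shows "(ida (tgt f) \<otimes>\<^sub>a duala dX dY f) \<circ>\<^sub>a coeva (tgt f) dY =
    (f \<otimes>\<^sub>a ida (dobj dX)) \<circ>\<^sub>a coeva (src f) dX"
proof -
  note [simp] = left_dual_arr(1,2)[OF assms(1)] left_dual_arr(1,2)[OF assms(2)] assms(3)
  let ?X = "src f" and ?Y = "tgt f" and ?x = "dobj dX" and ?y = "dobj dY"
  have "(ida ?Y \<otimes>\<^sub>a duala dX dY f) \<circ>\<^sub>a coeva ?Y dY = (ida ?Y \<otimes>\<^sub>a eva ?Y dY \<otimes>\<^sub>a ida ?x) \<circ>\<^sub>a
      (ida (?Y \<boxdot> ?y) \<otimes>\<^sub>a f \<otimes>\<^sub>a ida ?x) \<circ>\<^sub>a (ida (?Y \<boxdot> ?y) \<otimes>\<^sub>a coeva ?X dX) \<circ>\<^sub>a coeva ?Y dY"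
    using assms by (simp add: duala_eq whisker flip: tns_ida)
  also have "(ida (?Y \<boxdot> ?y) \<otimes>\<^sub>a coeva ?X dX) \<circ>\<^sub>a coeva ?Y dY =
      (coeva ?Y dY \<otimes>\<^sub>a ida (?X \<boxdot> ?x)) \<circ>\<^sub>a coeva ?X dX"
    using tns_split[of "coeva ?Y dY" "coeva ?X dX"] by simp
  also have "(ida ?Y \<otimes>\<^sub>a eva ?Y dY \<otimes>\<^sub>a ida ?x) \<circ>\<^sub>a (ida (?Y \<boxdot> ?y) \<otimes>\<^sub>a f \<otimes>\<^sub>a ida ?x) \<circ>\<^sub>a \<dots> =
      (((ida ?Y \<otimes>\<^sub>a eva ?Y dY) \<circ>\<^sub>a (coeva ?Y dY \<otimes>\<^sub>a ida ?Y)) \<otimes>\<^sub>a ida ?x) \<circ>\<^sub>a (f \<otimes>\<^sub>a ida ?x) \<circ>\<^sub>a coeva ?X dX"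
  proof -
    have "(ida (?Y \<boxdot> ?y) \<otimes>\<^sub>a f \<otimes>\<^sub>a ida ?x) \<circ>\<^sub>a (coeva ?Y dY \<otimes>\<^sub>a ida (?X \<boxdot> ?x)) =
        (coeva ?Y dY \<otimes>\<^sub>a ida (?Y \<boxdot> ?x)) \<circ>\<^sub>a (f \<otimes>\<^sub>a ida ?x)"
      using tns_split[of "coeva ?Y dY" "f \<otimes>\<^sub>a ida ?x"] by simp
    then have "(ida (?Y \<boxdot> ?y) \<otimes>\<^sub>a f \<otimes>\<^sub>a ida ?x) \<circ>\<^sub>a (coeva ?Y dY \<otimes>\<^sub>a ida (?X \<boxdot> ?x)) \<circ>\<^sub>a coeva ?X dX =
        (coeva ?Y dY \<otimes>\<^sub>a ida (?Y \<boxdot> ?x)) \<circ>\<^sub>a (f \<otimes>\<^sub>a ida ?x) \<circ>\<^sub>a coeva ?X dX"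
      by (simp flip: cmp_assoc)
    then show ?thesis by (simp add: whisker tns_ida)
  qed
  also have "\<dots> = (f \<otimes>\<^sub>a ida ?x) \<circ>\<^sub>a coeva ?X dX"
    by (simp add: left_dual_arr[OF assms(2)] tns_ida)
  finally show ?thesis .
qed

lemma duala_cmp:
  assumes "is_left_dual C (src f) dX" "is_left_dual C (tgt f) dY" "is_left_dual C (tgt g) dZ"
    "arr f" "arr g" "tgt f = src g"
  shows "duala dX dZ (g \<circ>\<^sub>a f) = duala dX dY f \<circ>\<^sub>a duala dY dZ g"
proof -
  let ?X = "src f" and ?Y = "tgt f" and ?Z = "tgt g" and ?x = "dobj dX" and ?y = "dobj dY" and ?z = "dobj dZ"
  note [simp] = left_dual_arr(1,2)[OF assms(1)] left_dual_arr(1,2)[OF assms(2)] left_dual_arr(1,2)[OF assms(3)] assms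
  have dY: "is_left_dual C (src g) dY" using assms by simp
  note [simp] = left_dual_arr(1,2)[OF dY] dY
  have "duala dX dZ (g \<circ>\<^sub>a f) = (eva ?Z dZ \<otimes>\<^sub>a ida ?x) \<circ>\<^sub>a (ida ?z \<otimes>\<^sub>a g \<otimes>\<^sub>a ida ?x) \<circ>\<^sub>a
      (ida ?z \<otimes>\<^sub>a ((f \<otimes>\<^sub>a ida ?x) \<circ>\<^sub>a coeva ?X dX))"
    by (simp add: duala_eq whisker)
  also have "\<dots> = (eva ?Z dZ \<otimes>\<^sub>a ida ?x) \<circ>\<^sub>a (ida ?z \<otimes>\<^sub>a g \<otimes>\<^sub>a ida ?x) \<circ>\<^sub>a
      (ida ?z \<otimes>\<^sub>a ((ida (src g) \<otimes>\<^sub>a duala dX dY f) \<circ>\<^sub>a coeva (src g) dY))"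
    using duala_coev[OF assms(1,2,4)] assms(6) by simp
  also have "\<dots> = (eva ?Z dZ \<otimes>\<^sub>a duala dX dY f) \<circ>\<^sub>a (ida ?z \<otimes>\<^sub>a g \<otimes>\<^sub>a ida ?y) \<circ>\<^sub>a (ida ?z \<otimes>\<^sub>a coeva (src g) dY)"
  proof -
    have "eva ?Z dZ \<otimes>\<^sub>a duala dX dY f = (eva ?Z dZ \<otimes>\<^sub>a ida ?x) \<circ>\<^sub>a (ida ?z \<otimes>\<^sub>a ida ?Z \<otimes>\<^sub>a duala dX dY f)"
      using tns_split_left[of "eva ?Z dZ" "duala dX dY f"] by (simp flip: tns_ida)
    then show ?thesis by (simp add: interchange interchange')
  qed
  also have "\<dots> = duala dX dY f \<circ>\<^sub>a duala dY dZ g"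
    using tns_split_right[of "eva ?Z dZ" "duala dX dY f"] dY by (simp add: duala_eq[of g dY dZ])
  finally show ?thesis .
qed

section \<open>Frobenius algebras and their Casimir elements\<close>

definition mu :: "('a, 'b) frob \<Rightarrow> ('a, 'b) arrow" where
  "mu X = Arrow (fobj X \<boxdot> fobj X) (fobj X) (fmul X)"

definition de :: "('a, 'b) frob \<Rightarrow> ('a, 'b) arrow" where
  "de X = Arrow (fobj X) (fobj X \<boxdot> fobj X) (fcomul X)"

definition et :: "('a, 'b) frob \<Rightarrow> ('a, 'b) arrow" where
  "et X = Arrow (unit C) (fobj X) (funit X)"

definition ep :: "('a, 'b) frob \<Rightarrow> ('a, 'b) arrow" where
  "ep X = Arrow (fobj X) (unit C) (fcounit X)"

lemma frob_ends [simp]: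
  "src (mu X) = fobj X \<boxdot> fobj X" "tgt (mu X) = fobj X"
  "src (de X) = fobj X" "tgt (de X) = fobj X \<boxdot> fobj X"
  "src (et X) = unit C" "tgt (et X) = fobj X"
  "src (ep X) = fobj X" "tgt (ep X) = unit C"
  by (simp_all add: mu_def de_def et_def ep_def)

lemma frob_dual_obj [simp]: "dobj (frob_dual C X) = fobj X"
  by (simp add: frob_dual_def)

lemma frobenius_arrows:
  assumes "frobenius_algebra C X"
  shows frob_arr: "arr (mu X)" "arr (de X)" "arr (et X)" "arr (ep X)"
    and mu_assoc: "mu X \<circ>\<^sub>a (mu X \<otimes>\<^sub>a ida (fobj X)) = mu X \<circ>\<^sub>a (ida (fobj X) \<otimes>\<^sub>a mu X)"
    and mu_unit: "mu X \<circ>\<^sub>a (et X \<otimes>\<^sub>a ida (fobj X)) = ida (fobj X)"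
      "mu X \<circ>\<^sub>a (ida (fobj X) \<otimes>\<^sub>a et X) = ida (fobj X)"
    and de_counit: "(ep X \<otimes>\<^sub>a ida (fobj X)) \<circ>\<^sub>a de X = ida (fobj X)"
      "(ida (fobj X) \<otimes>\<^sub>a ep X) \<circ>\<^sub>a de X = ida (fobj X)"
    and frobenius: "(ida (fobj X) \<otimes>\<^sub>a mu X) \<circ>\<^sub>a (de X \<otimes>\<^sub>a ida (fobj X)) = de X \<circ>\<^sub>a mu X"
      "(mu X \<otimes>\<^sub>a ida (fobj X)) \<circ>\<^sub>a (ida (fobj X) \<otimes>\<^sub>a de X) = de X \<circ>\<^sub>a mu X"
  using assms
  by (auto simp: frobenius_algebra_def algebra_in_def coalgebra_in_def arr_def mu_def de_def et_def
      ep_def cmp_def tns_def ida_def)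

text \<open>
  For the selfduality of \<open>X\<close> this is the coevaluation.
\<close>

definition casimir :: "('a, 'b) frob \<Rightarrow> ('a, 'b) arrow" where
  "casimir X = de X \<circ>\<^sub>a et X"

lemma casimir_ends [simp]: "src (casimir X) = unit C" "tgt (casimir X) = fobj X \<boxdot> fobj X"
  by (simp_all add: casimir_def)

text \<open>
  Multiplying the Casimir element from the left or from the right gives the comultiplication; in
  particular, both give the same result: the Casimir element is central.
\<close>

lemma frobenius_casimir:
  assumes "frobenius_algebra C X"
  shows arr_casimir: "arr (casimir X)"
    and casimir_left: "(mu X \<otimes>\<^sub>a ida (fobj X)) \<circ>\<^sub>a (ida (fobj X) \<otimes>\<^sub>a casimir X) = de X"
    and casimir_right: "(ida (fobj X) \<otimes>\<^sub>a mu X) \<circ>\<^sub>a (casimir X \<otimes>\<^sub>a ida (fobj X)) = de X"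
proof -
  note [simp] = frob_arr[OF assms]
  show "arr (casimir X)" by (simp add: casimir_def)
  have "(mu X \<otimes>\<^sub>a ida (fobj X)) \<circ>\<^sub>a (ida (fobj X) \<otimes>\<^sub>a casimir X) =
      ((mu X \<otimes>\<^sub>a ida (fobj X)) \<circ>\<^sub>a (ida (fobj X) \<otimes>\<^sub>a de X)) \<circ>\<^sub>a (ida (fobj X) \<otimes>\<^sub>a et X)"
    by (simp add: casimir_def whisker)
  also have "\<dots> = de X" unfolding frobenius[OF assms] by (simp add: mu_unit[OF assms])
  finally show "(mu X \<otimes>\<^sub>a ida (fobj X)) \<circ>\<^sub>a (ida (fobj X) \<otimes>\<^sub>a casimir X) = de X" .
  have "(ida (fobj X) \<otimes>\<^sub>a mu X) \<circ>\<^sub>a (casimir X \<otimes>\<^sub>a ida (fobj X)) =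
      ((ida (fobj X) \<otimes>\<^sub>a mu X) \<circ>\<^sub>a (de X \<otimes>\<^sub>a ida (fobj X))) \<circ>\<^sub>a (et X \<otimes>\<^sub>a ida (fobj X))"
    by (simp add: casimir_def whisker)
  also have "\<dots> = de X" unfolding frobenius[OF assms] by (simp add: mu_unit[OF assms])
  finally show "(ida (fobj X) \<otimes>\<^sub>a mu X) \<circ>\<^sub>a (casimir X \<otimes>\<^sub>a ida (fobj X)) = de X" .
qed

lemma frob_dual_ev: "eva (fobj X) (frob_dual C X) = ep X \<circ>\<^sub>a mu X"
    "coeva (fobj X) (frob_dual C X) = casimir X"
  by (simp_all add: eva_def coeva_def frob_dual_def cmp_def casimir_def ep_def mu_def de_def et_def)

lemma frob_dual_is_left_dual:
  assumes "frobenius_algebra C X"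
  shows "is_left_dual C (fobj X) (frob_dual C X)"
proof -
  note [simp] = frob_arr[OF assms] arr_casimir[OF assms]
  let ?A = "fobj X" and ?ev = "eva (fobj X) (frob_dual C X)" and ?co = "coeva (fobj X) (frob_dual C X)"
  have "(ida ?A \<otimes>\<^sub>a ?ev) \<circ>\<^sub>a (?co \<otimes>\<^sub>a ida ?A) =
      (ida ?A \<otimes>\<^sub>a ep X) \<circ>\<^sub>a (ida ?A \<otimes>\<^sub>a mu X) \<circ>\<^sub>a (casimir X \<otimes>\<^sub>a ida ?A)"
    by (simp add: frob_dual_ev whisker)
  then have zig: "(ida ?A \<otimes>\<^sub>a ?ev) \<circ>\<^sub>a (?co \<otimes>\<^sub>a ida ?A) = ida ?A"
    by (simp add: casimir_right[OF assms] de_counit[OF assms])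
  have "(?ev \<otimes>\<^sub>a ida ?A) \<circ>\<^sub>a (ida ?A \<otimes>\<^sub>a ?co) =
      (ep X \<otimes>\<^sub>a ida ?A) \<circ>\<^sub>a (mu X \<otimes>\<^sub>a ida ?A) \<circ>\<^sub>a (ida ?A \<otimes>\<^sub>a casimir X)"
    by (simp add: frob_dual_ev whisker)
  then have zag: "(?ev \<otimes>\<^sub>a ida ?A) \<circ>\<^sub>a (ida ?A \<otimes>\<^sub>a ?co) = ida ?A"
    by (simp add: casimir_left[OF assms] de_counit[OF assms])
  have "arr ?ev" "arr ?co" by (simp_all add: frob_dual_ev)
  then show ?thesis
    using arg_cong[OF zig, of mor] arg_cong[OF zag, of mor]
    by (simp add: is_left_dual_def mor_simps arr_def) (simp add: eva_def coeva_def)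
qed

section \<open>Rigidity of separable subalgebras\<close>

text \<open>
  In the comments below, morphisms are evaluated on symbolic elements, and the arrow \<open>p : 1 \<rightarrow> X \<otimes> X\<close> is
  written \<open>\<Sum> a\<^sub>k \<otimes> b\<^sub>k\<close>; the proofs use the corresponding identities between arrows.
\<close>

definition subalgebra_idem :: "('a, 'b) frob \<Rightarrow> ('a, 'b) arrow \<Rightarrow> bool" where
  "subalgebra_idem X x \<longleftrightarrow> arr x \<and> src x = fobj X \<and> tgt x = fobj X \<and>
     x \<circ>\<^sub>a mu X \<circ>\<^sub>a (x \<otimes>\<^sub>a x) = mu X \<circ>\<^sub>a (x \<otimes>\<^sub>a x) \<and> x \<circ>\<^sub>a x = x"

text \<open>
  Up to the scalar \<open>l\<close>, the arrow \<open>p\<close> is a separability idempotent of the image of \<open>b\<close>: it has both legs in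
  the image, its product is \<open>l e\<close>, and \<open>\<Sum> y a\<^sub>k \<otimes> b\<^sub>k = \<Sum> a\<^sub>k \<otimes> b\<^sub>k y\<close> for \<open>y\<close> in the image.
\<close>

definition separability_elem :: "('a, 'b) frob \<Rightarrow> ('a, 'b) arrow \<Rightarrow> ('a, 'b) arrow \<Rightarrow> complex \<Rightarrow> bool" where
  "separability_elem X b p l \<longleftrightarrow> arr p \<and> src p = unit C \<and> tgt p = fobj X \<boxdot> fobj X \<and>
     (b \<otimes>\<^sub>a b) \<circ>\<^sub>a p = p \<and> mu X \<circ>\<^sub>a p = sca l (et X) \<and> l \<noteq> 0 \<and>
     (mu X \<otimes>\<^sub>a ida (fobj X)) \<circ>\<^sub>a (b \<otimes>\<^sub>a p) = (ida (fobj X) \<otimes>\<^sub>a mu X) \<circ>\<^sub>a (p \<otimes>\<^sub>a b)"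

text \<open>
  This is the map \<open>y \<mapsto> \<Sum> x(b(y) b(a\<^sub>k)) d(b\<^sub>k)\<close>.  If \<open>x\<close> is the identity and \<open>d\<close> is a derivation on the
  image of \<open>b\<close>, it multiplies \<open>y\<close> by the element which implements \<open>l d\<close> as an inner derivation.
\<close>

definition insertion :: "('a, 'b) frob \<Rightarrow> ('a, 'b) arrow \<Rightarrow> ('a, 'b) arrow \<Rightarrow> ('a, 'b) arrow \<Rightarrow> ('a, 'b) arrow \<Rightarrow> ('a, 'b) arrow" where
  "insertion X b p x d = mu X \<circ>\<^sub>a ((x \<circ>\<^sub>a mu X \<circ>\<^sub>a (b \<otimes>\<^sub>a b)) \<otimes>\<^sub>a d) \<circ>\<^sub>a (ida (fobj X) \<otimes>\<^sub>a p)"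

text \<open>
  Put \<open>q = 1 - x\<close> and \<open>d = q b\<close>.  For \<open>y\<close> in the image of \<open>b\<close>, centrality of \<open>p\<close> and the fact that the image
  of \<open>x\<close> is closed under products (so that \<open>q(x(v) q(w)) = q(x(v) w)\<close>) give
  \<open>\<Sum> q(x(y a\<^sub>k) q(b\<^sub>k)) = \<Sum> q(x(y a\<^sub>k) b\<^sub>k) = \<Sum> q(x(a\<^sub>k) b\<^sub>k y) = u q(y)\<close>.
\<close>

lemma insertion_defect:
  assumes X: "frobenius_algebra C X" and b: "subalgebra_idem X b" and p: "separability_elem X b p l" and x: "subalgebra_idem X x"
    and u: "mu X \<circ>\<^sub>a (x \<otimes>\<^sub>a ida (fobj X)) \<circ>\<^sub>a p = sca u (et X)"
  shows "(ida (fobj X) \<ominus>\<^sub>a x) \<circ>\<^sub>a insertion X b p x ((ida (fobj X) \<ominus>\<^sub>a x) \<circ>\<^sub>a b) = sca u ((ida (fobj X) \<ominus>\<^sub>a x) \<circ>\<^sub>a b)"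
proof -
  define q where "q = ida (fobj X) \<ominus>\<^sub>a x"
  let ?A = "fobj X" and ?I = "ida (fobj X)"
  note [simp] = frob_arr[OF X]
  have [simp]: "arr b" "src b = ?A" "tgt b = ?A" "arr x" "src x = ?A" "tgt x = ?A"
    "arr p" "src p = unit C" "tgt p = ?A \<boxdot> ?A"
    using b p x by (auto simp: subalgebra_idem_def separability_elem_def)
  have [simp]: "arr q" "src q = ?A" "tgt q = ?A" by (simp_all add: q_def)
  have bp: "(b \<otimes>\<^sub>a b) \<circ>\<^sub>a p = p" and casim: "(mu X \<otimes>\<^sub>a ?I) \<circ>\<^sub>a (b \<otimes>\<^sub>a p) = (?I \<otimes>\<^sub>a mu X) \<circ>\<^sub>a (p \<otimes>\<^sub>a b)"
    using p by (auto simp: separability_elem_def)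
  have xx: "x \<circ>\<^sub>a mu X \<circ>\<^sub>a (x \<otimes>\<^sub>a x) = mu X \<circ>\<^sub>a (x \<otimes>\<^sub>a x)" using x by (simp add: subalgebra_idem_def)
  \<comment> \<open>Both sides differ by a product of two elements in the image of \<open>x\<close>, which \<open>q\<close> kills.\<close>
  have qq: "q \<circ>\<^sub>a mu X \<circ>\<^sub>a (x \<otimes>\<^sub>a q) = q \<circ>\<^sub>a mu X \<circ>\<^sub>a (x \<otimes>\<^sub>a ?I)"
  proof -
    have "q \<circ>\<^sub>a mu X \<circ>\<^sub>a (x \<otimes>\<^sub>a q) = (mu X \<circ>\<^sub>a (x \<otimes>\<^sub>a ?I) \<ominus>\<^sub>a mu X \<circ>\<^sub>a (x \<otimes>\<^sub>a x)) \<ominus>\<^sub>a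
        (x \<circ>\<^sub>a mu X \<circ>\<^sub>a (x \<otimes>\<^sub>a ?I) \<ominus>\<^sub>a mu X \<circ>\<^sub>a (x \<otimes>\<^sub>a x))"
      by (simp add: q_def dif_simps xx) (simp add: dif_def algebra_simps)
    also have "\<dots> = q \<circ>\<^sub>a mu X \<circ>\<^sub>a (x \<otimes>\<^sub>a ?I)" by (simp add: q_def dif_simps) (simp add: dif_def algebra_simps)
    finally show ?thesis .
  qed
  have "q \<circ>\<^sub>a insertion X b p x (q \<circ>\<^sub>a b) =
      (q \<circ>\<^sub>a mu X \<circ>\<^sub>a (x \<otimes>\<^sub>a q)) \<circ>\<^sub>a (mu X \<otimes>\<^sub>a ?I) \<circ>\<^sub>a (b \<otimes>\<^sub>a ((b \<otimes>\<^sub>a b) \<circ>\<^sub>a p))"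
  proof -
    have "(x \<circ>\<^sub>a mu X \<circ>\<^sub>a (b \<otimes>\<^sub>a b)) \<otimes>\<^sub>a (q \<circ>\<^sub>a b) = (x \<otimes>\<^sub>a q) \<circ>\<^sub>a (mu X \<otimes>\<^sub>a ?I) \<circ>\<^sub>a (b \<otimes>\<^sub>a b \<otimes>\<^sub>a b)"
      using interchange[of "b \<otimes>\<^sub>a b" "mu X" b ?I] by (simp add: interchange)
    then show ?thesis by (simp add: insertion_def interchange interchange')
  qed
  also have "\<dots> = q \<circ>\<^sub>a mu X \<circ>\<^sub>a (x \<otimes>\<^sub>a ?I) \<circ>\<^sub>a (?I \<otimes>\<^sub>a mu X) \<circ>\<^sub>a (p \<otimes>\<^sub>a b)"
    unfolding bp qq casim by simp
  also have "\<dots> = q \<circ>\<^sub>a (mu X \<circ>\<^sub>a (?I \<otimes>\<^sub>a mu X)) \<circ>\<^sub>a (x \<otimes>\<^sub>a ?I \<otimes>\<^sub>a ?I) \<circ>\<^sub>a (p \<otimes>\<^sub>a b)"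
    by (simp add: interchange')
  also have "\<dots> = q \<circ>\<^sub>a mu X \<circ>\<^sub>a ((mu X \<circ>\<^sub>a (x \<otimes>\<^sub>a ?I) \<circ>\<^sub>a p) \<otimes>\<^sub>a b)"
  proof -
    have "(x \<otimes>\<^sub>a ?I \<otimes>\<^sub>a ?I) \<circ>\<^sub>a (p \<otimes>\<^sub>a b) = ((x \<otimes>\<^sub>a ?I) \<circ>\<^sub>a p) \<otimes>\<^sub>a b"
      using interchange[of p "x \<otimes>\<^sub>a ?I" b ?I] by simp
    then show ?thesis unfolding mu_assoc[OF X, symmetric] by (simp add: interchange)
  qed
  also have "\<dots> = sca u (q \<circ>\<^sub>a (mu X \<circ>\<^sub>a (et X \<otimes>\<^sub>a ?I)) \<circ>\<^sub>a b)"
    using tns_split_left[of "et X" b] by (simp add: u sca_simps)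
  also have "\<dots> = sca u (q \<circ>\<^sub>a b)" by (simp add: mu_unit[OF X])
  finally show ?thesis unfolding q_def .
qed

text \<open>
  For \<open>x = b\<close> the inserted element is \<open>\<Sum> b(y) a\<^sub>k d(b\<^sub>k) = t b(y)\<close>, which \<open>1 - b\<close> kills.  The value of
  \<open>d\<close> matters only through the scalar \<open>t\<close>, which exists when \<open>X\<close> is connected.
\<close>

lemma insertion_self:
  assumes X: "frobenius_algebra C X" and b: "subalgebra_idem X b" and p: "separability_elem X b p l"
    and d: "arr d" "src d = fobj X" "tgt d = fobj X"
    and t: "mu X \<circ>\<^sub>a (b \<otimes>\<^sub>a d) \<circ>\<^sub>a p = sca t (et X)"
  shows "mor ((ida (fobj X) \<ominus>\<^sub>a b) \<circ>\<^sub>a insertion X b p b d) = 0"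
proof -
  define q where "q = ida (fobj X) \<ominus>\<^sub>a b"
  let ?A = "fobj X" and ?I = "ida (fobj X)"
  note [simp] = frob_arr[OF X] d
  have [simp]: "arr b" "src b = ?A" "tgt b = ?A" "arr p" "src p = unit C" "tgt p = ?A \<boxdot> ?A"
    using b p by (auto simp: subalgebra_idem_def separability_elem_def)
  have [simp]: "arr q" "src q = ?A" "tgt q = ?A" by (simp_all add: q_def)
  have bb: "b \<circ>\<^sub>a mu X \<circ>\<^sub>a (b \<otimes>\<^sub>a b) = mu X \<circ>\<^sub>a (b \<otimes>\<^sub>a b)" "b \<circ>\<^sub>a b = b" using b by (simp_all add: subalgebra_idem_def)
  have "q \<circ>\<^sub>a insertion X b p b d = q \<circ>\<^sub>a (mu X \<circ>\<^sub>a (mu X \<otimes>\<^sub>a ?I)) \<circ>\<^sub>a (b \<otimes>\<^sub>a ((b \<otimes>\<^sub>a d) \<circ>\<^sub>a p))"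
  proof -
    have "(mu X \<circ>\<^sub>a (b \<otimes>\<^sub>a b)) \<otimes>\<^sub>a d = (mu X \<otimes>\<^sub>a ?I) \<circ>\<^sub>a (b \<otimes>\<^sub>a b \<otimes>\<^sub>a d)"
      using interchange[of "b \<otimes>\<^sub>a b" "mu X" d ?I] by simp
    then show ?thesis by (simp add: insertion_def bb interchange interchange')
  qed
  also have "\<dots> = q \<circ>\<^sub>a mu X \<circ>\<^sub>a (b \<otimes>\<^sub>a (mu X \<circ>\<^sub>a (b \<otimes>\<^sub>a d) \<circ>\<^sub>a p))"
    unfolding mu_assoc[OF X] by (simp add: interchange)
  also have "\<dots> = sca t (q \<circ>\<^sub>a (mu X \<circ>\<^sub>a (?I \<otimes>\<^sub>a et X)) \<circ>\<^sub>a b)"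
    using tns_split_right[of b "et X"] by (simp add: t sca_simps)
  also have "\<dots> = sca t (b \<ominus>\<^sub>a b)" by (simp add: mu_unit[OF X]) (simp add: q_def dif_simps bb)
  finally show ?thesis
    unfolding q_def by (simp add: mor_simps mor_dif scl_zero)
qed

lemma separability_elem_left:
  assumes "subalgebra_idem X b" "separability_elem X b p l"
  shows "mu X \<circ>\<^sub>a (b \<otimes>\<^sub>a ida (fobj X)) \<circ>\<^sub>a p = sca l (et X)"
proof -
  have [simp]: "arr b" "src b = fobj X" "tgt b = fobj X" "arr p" "src p = unit C" "tgt p = fobj X \<boxdot> fobj X"
    and bp: "(b \<otimes>\<^sub>a b) \<circ>\<^sub>a p = p" and bb: "b \<circ>\<^sub>a b = b" and l: "mu X \<circ>\<^sub>a p = sca l (et X)"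
    using assms by (auto simp: subalgebra_idem_def separability_elem_def)
  have "(b \<otimes>\<^sub>a ida (fobj X)) \<circ>\<^sub>a (b \<otimes>\<^sub>a b) \<circ>\<^sub>a p = (b \<otimes>\<^sub>a b) \<circ>\<^sub>a p"
    by (simp add: interchange' bb)
  then show ?thesis by (simp add: bp l)
qed

section \<open>Connected Frobenius algebras and the quasi-pivotal structure\<close>

text \<open>
  If the unit vanishes then so does the identity of \<open>X\<close>, and \<open>Hom(1, X)\<close> has dimension \<open>0\<close>.
\<close>

lemma frob_unit_nonzero:
  assumes X: "frobenius_algebra C X" and con: "connected_frob C X"
  shows "funit X \<noteq> 0"
proof
  interpret vector_space "scl C" by (rule vector_space_scl)
  note [simp] = frob_arr[OF X]
  assume 0: "funit X = 0"
  have et0: "et X = sca 0 (et X)" by (rule arrow_eqI) (simp_all add: mor_simps et_def 0)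
  have "f = 0" if f: "f \<in> Hom C (unit C) (fobj X)" for f
  proof -
    let ?f = "Arrow (unit C) (fobj X) f"
    have [simp]: "arr ?f" using f by (simp add: arr_def)
    have "?f = mu X \<circ>\<^sub>a (et X \<otimes>\<^sub>a ida (fobj X)) \<circ>\<^sub>a ?f"
      using mu_unit(1)[OF X] by (simp flip: cmp_assoc)
    also have "\<dots> = sca 0 ?f"
      by (subst et0) (use mu_unit(1)[OF X] in \<open>simp add: sca_simps flip: cmp_assoc\<close>)
    finally have "mor ?f = mor (sca 0 ?f)" by simp
    then show ?thesis by (simp add: mor_simps)
  qed
  then have "Hom C (unit C) (fobj X) \<subseteq> {0}" by blast
  then have "dim (Hom C (unit C) (fobj X)) \<le> card ({} :: 'b set)"
    by (intro dim_le_card) auto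
  with con show False by (simp add: connected_frob_def)
qed

lemma connected_scalar:
  assumes X: "frobenius_algebra C X" and con: "connected_frob C X" and f: "f \<in> Hom C (unit C) (fobj X)"
  shows "\<exists>!c. f = scl C c (funit X)"
proof -
  interpret vector_space "scl C" by (rule vector_space_scl)
  obtain B where B: "B \<subseteq> Hom C (unit C) (fobj X)" "independent B" "Hom C (unit C) (fobj X) \<subseteq> span B"
    "card B = dim (Hom C (unit C) (fobj X))" using basis_exists by blast
  then obtain v where v: "B = {v}" using con by (auto simp: connected_frob_def card_1_singleton_iff)
  have ex: "\<exists>c. g = scl C c v" if "g \<in> Hom C (unit C) (fobj X)" for g
    using that B(3) unfolding v span_singleton by auto
  have e: "funit X \<in> Hom C (unit C) (fobj X)" using frob_arr(3)[OF X] by (simp add: arr_def et_def)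
  obtain a c where a: "funit X = scl C a v" and c: "f = scl C c v" using ex e f by blast
  have "a \<noteq> 0" using frob_unit_nonzero[OF X con] a by auto
  then have "f = scl C (c / a) (funit X)" by (simp add: a c)
  moreover have "x = y" if "f = scl C x (funit X)" "f = scl C y (funit X)" for x y
    using that frob_unit_nonzero[OF X con] scale_right_imp_eq by metis
  ultimately show ?thesis by metis
qed

lemma connected_arrow:
  assumes X: "frobenius_algebra C X" and con: "connected_frob C X"
    and f: "arr f" "src f = unit C" "tgt f = fobj X"
  shows "\<exists>c. f = sca c (et X)"
proof -
  obtain c where "mor f = scl C c (funit X)"
    using connected_scalar[OF X con, of "mor f"] f by (auto simp: arr_def)
  then show ?thesis using f by (intro exI[of _ c] arrow_eqI) (simp_all add: mor_simps et_def)
qed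

text \<open>
  Let \<open>\<Sum> h(a\<^sub>k) b\<^sub>k = c e\<close> for the Casimir element \<open>\<Sum> a\<^sub>k \<otimes> b\<^sub>k\<close> of \<open>X\<close>; the assumption on the trace says
  that \<open>c \<noteq> 0\<close>.  Centrality of the Casimir element and multiplicativity of \<open>h\<close> give
  \<open>c h(y) = \<Sum> h(y a\<^sub>k) b\<^sub>k = \<Sum> h(a\<^sub>k) b\<^sub>k y = c y\<close>.
\<close>

lemma algebra_endomorphism_with_trace:
  assumes X: "frobenius_algebra C X" and con: "connected_frob C X"
    and h: "arr h" "src h = fobj X" "tgt h = fobj X"
    and mult: "mu X \<circ>\<^sub>a (h \<otimes>\<^sub>a h) = h \<circ>\<^sub>a mu X"
    and trace: "mor (ep X \<circ>\<^sub>a mu X \<circ>\<^sub>a (h \<otimes>\<^sub>a ida (fobj X)) \<circ>\<^sub>a casimir X) \<noteq> 0"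
  shows "h = ida (fobj X)"
proof -
  note [simp] = frob_arr[OF X] arr_casimir[OF X] h
  let ?A = "fobj X" and ?I = "ida (fobj X)"
  obtain c where c: "mu X \<circ>\<^sub>a (h \<otimes>\<^sub>a ?I) \<circ>\<^sub>a casimir X = sca c (et X)"
    using connected_arrow[OF X con, of "mu X \<circ>\<^sub>a (h \<otimes>\<^sub>a ?I) \<circ>\<^sub>a casimir X"] by auto
  have "c \<noteq> 0"
    using trace by (auto simp: c sca_simps mor_simps scl_zero)
  have "mu X \<circ>\<^sub>a (h \<otimes>\<^sub>a ?I) \<circ>\<^sub>a (mu X \<otimes>\<^sub>a ?I) \<circ>\<^sub>a (?I \<otimes>\<^sub>a casimir X) = sca c h"
  proof -
    have "mu X \<circ>\<^sub>a (h \<otimes>\<^sub>a ?I) \<circ>\<^sub>a (mu X \<otimes>\<^sub>a ?I) \<circ>\<^sub>a (?I \<otimes>\<^sub>a casimir X) =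
        mu X \<circ>\<^sub>a ((mu X \<circ>\<^sub>a (h \<otimes>\<^sub>a h)) \<otimes>\<^sub>a ?I) \<circ>\<^sub>a (?I \<otimes>\<^sub>a casimir X)"
      by (simp add: mult interchange')
    also have "\<dots> = (mu X \<circ>\<^sub>a (mu X \<otimes>\<^sub>a ?I)) \<circ>\<^sub>a (h \<otimes>\<^sub>a h \<otimes>\<^sub>a ?I) \<circ>\<^sub>a (?I \<otimes>\<^sub>a casimir X)"
      by (simp add: whisker)
    also have "\<dots> = mu X \<circ>\<^sub>a (h \<otimes>\<^sub>a (mu X \<circ>\<^sub>a (h \<otimes>\<^sub>a ?I) \<circ>\<^sub>a casimir X))"
      unfolding mu_assoc[OF X] by (simp add: interchange)
    also have "\<dots> = sca c ((mu X \<circ>\<^sub>a (?I \<otimes>\<^sub>a et X)) \<circ>\<^sub>a h)"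
      using tns_split_right[of h "et X"] by (simp add: c sca_simps)
    finally show ?thesis by (simp add: mu_unit[OF X])
  qed
  moreover have "mu X \<circ>\<^sub>a (h \<otimes>\<^sub>a ?I) \<circ>\<^sub>a (?I \<otimes>\<^sub>a mu X) \<circ>\<^sub>a (casimir X \<otimes>\<^sub>a ?I) = sca c ?I"
  proof -
    have "mu X \<circ>\<^sub>a (h \<otimes>\<^sub>a ?I) \<circ>\<^sub>a (?I \<otimes>\<^sub>a mu X) \<circ>\<^sub>a (casimir X \<otimes>\<^sub>a ?I) =
        (mu X \<circ>\<^sub>a (?I \<otimes>\<^sub>a mu X)) \<circ>\<^sub>a (h \<otimes>\<^sub>a ?I \<otimes>\<^sub>a ?I) \<circ>\<^sub>a (casimir X \<otimes>\<^sub>a ?I)"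
      by (simp add: interchange')
    also have "\<dots> = mu X \<circ>\<^sub>a ((mu X \<circ>\<^sub>a (h \<otimes>\<^sub>a ?I) \<circ>\<^sub>a casimir X) \<otimes>\<^sub>a ?I)"
      unfolding mu_assoc[OF X, symmetric] by (simp add: whisker)
    also have "\<dots> = sca c ?I" by (simp add: c sca_simps mu_unit[OF X])
    finally show ?thesis .
  qed
  ultimately have eq: "sca c h = sca c ?I" by (simp add: casimir_left[OF X] casimir_right[OF X])
  interpret vector_space "scl C" by (rule vector_space_scl)
  have "mor h = mor ?I" using arg_cong[OF eq, of mor] \<open>c \<noteq> 0\<close> by (simp add: mor_simps)
  then show ?thesis by (intro arrow_eqI) simp_all
qed

lemma scalar_of_zero:
  assumes "idm C (unit C) \<noteq> 0"
  shows "scalar_of C 0 = 0"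
proof -
  interpret vector_space "scl C" by (rule vector_space_scl)
  show ?thesis unfolding scalar_of_def using assms by (intro the_equality) auto
qed

lemma tr_arrow:
  assumes "duality C D" "arr h" "src h = Y" "tgt h = ddual_obj D Y"
  shows "tr C D Y (mor h) = scalar_of C (mor (eva (dobj (D Y)) (D (dobj (D Y))) \<circ>\<^sub>a
     (h \<otimes>\<^sub>a ida (dobj (D Y))) \<circ>\<^sub>a coeva Y (D Y)))"
proof -
  have l: "is_left_dual C Y (D Y)" "is_left_dual C (dobj (D Y)) (D (dobj (D Y)))"
    using assms(1) by (simp_all add: duality_def)
  note [simp] = left_dual_arr(1,2)[OF l(1)] left_dual_arr(1,2)[OF l(2)] assms(2-4)
  have "tr C D Y (mor h) = scalar_of C (mor ((eva (dobj (D Y)) (D (dobj (D Y))) \<circ>\<^sub>a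
     (h \<otimes>\<^sub>a ida (dobj (D Y)))) \<circ>\<^sub>a coeva Y (D Y)))"
    by (simp add: tr_def mor_simps del: cmp_assoc) (simp add: eva_def coeva_def)
  then show ?thesis by (simp add: ddual_obj_def)
qed

text \<open>
  With its own selfduality \<open>X\<close> is its double dual, so \<open>\<phi>\<^sub>X\<close> is an algebra endomorphism of \<open>X\<close> with nonzero
  trace.
\<close>

lemma pivotal_identity:
  assumes X: "frobenius_algebra C X" and con: "connected_frob C X" and one: "idm C (unit C) \<noteq> 0"
    and D: "duality C D" and DX: "D (fobj X) = frob_dual C X" and wp: "weakly_positive C D \<phi>"
    and mult: "fmul X \<cdot> (\<phi> (fobj X) \<boxtimes> \<phi> (fobj X)) = \<phi> (fobj X) \<cdot> fmul X"
  shows "\<phi> (fobj X) = idm C (fobj X)"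
proof -
  note [simp] = frob_arr[OF X] arr_casimir[OF X]
  define h where "h = Arrow (fobj X) (fobj X) (\<phi> (fobj X))"
  have [simp]: "src h = fobj X" "tgt h = fobj X" "mor h = \<phi> (fobj X)" by (simp_all add: h_def)
  have dd: "ddual_obj D (fobj X) = fobj X" by (simp add: ddual_obj_def DX)
  have "\<phi> (fobj X) \<in> Hom C (fobj X) (fobj X)"
    using wp dd unfolding weakly_positive_def quasi_pivotal_def iso_in_def by metis
  then have [simp]: "arr h" by (simp add: arr_def)
  have "\<not> zero_object C (fobj X)"
  proof
    assume "zero_object C (fobj X)"
    then have "funit X \<in> {0}" using frob_arr(3)[OF X] by (auto simp: zero_object_def arr_def et_def)
    with frob_unit_nonzero[OF X con] show False by simp
  qed
  then have "tr C D (fobj X) (mor h) \<noteq> 0" using wp by (auto simp: weakly_positive_def)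
  then have "scalar_of C (mor (ep X \<circ>\<^sub>a mu X \<circ>\<^sub>a (h \<otimes>\<^sub>a ida (fobj X)) \<circ>\<^sub>a casimir X)) \<noteq> 0"
    by (subst (asm) tr_arrow[OF D]) (simp_all add: dd DX frob_dual_ev)
  then have tr: "mor (ep X \<circ>\<^sub>a mu X \<circ>\<^sub>a (h \<otimes>\<^sub>a ida (fobj X)) \<circ>\<^sub>a casimir X) \<noteq> 0"
    using scalar_of_zero[OF one] by auto
  have "mu X \<circ>\<^sub>a (h \<otimes>\<^sub>a h) = h \<circ>\<^sub>a mu X"
    using mult by (simp add: cmp_def tns_def mu_def)
  from algebra_endomorphism_with_trace[OF X con _ _ _ this tr]
  have "h = ida (fobj X)" by simp
  then have "mor h = mor (ida (fobj X))" by simp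
  then show ?thesis by (simp add: mor_simps)
qed

section \<open>Frobenius subalgebras are separable\<close>

lemma frob_star_arrow:
  "duala (frob_dual C A) (frob_dual C X) (Arrow (fobj A) (fobj X) i) = Arrow (fobj X) (fobj A) (frob_star C A X i)"
  by (simp add: duala_def frob_star_def)

lemma frobenius_subalgebra_arrows:
  assumes X: "frobenius_algebra C X" and sub: "frobenius_subalgebra C X A i"
  defines "j \<equiv> Arrow (fobj A) (fobj X) i"
    and "s \<equiv> Arrow (fobj X) (fobj A) (frob_star C A X i)"
  shows "arr j" "arr s" "mu X \<circ>\<^sub>a (j \<otimes>\<^sub>a j) = j \<circ>\<^sub>a mu A" "j \<circ>\<^sub>a et A = et X" "s \<circ>\<^sub>a j = ida (fobj A)"
    "duala (frob_dual C A) (frob_dual C X) j = s" "duala (frob_dual C X) (frob_dual C A) s = j"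
proof -
  have A: "frobenius_algebra C A" using sub by (simp add: frobenius_subalgebra_def)
  show j: "arr j" using sub by (simp add: frobenius_subalgebra_def mono_in_def arr_def j_def)
  show s: "duala (frob_dual C A) (frob_dual C X) j = s" by (simp add: j_def s_def frob_star_arrow)
  show "arr s" unfolding s[symmetric]
    by (rule arr_duala) (simp_all add: j, simp_all add: j_def frob_dual_is_left_dual A X)
  show "mu X \<circ>\<^sub>a (j \<otimes>\<^sub>a j) = j \<circ>\<^sub>a mu A" "j \<circ>\<^sub>a et A = et X" "s \<circ>\<^sub>a j = ida (fobj A)"
    "duala (frob_dual C X) (frob_dual C A) s = j"
    using sub by (auto simp: frobenius_subalgebra_def j_def s_def cmp_def tns_def ida_def mu_def et_def
        frob_star_arrow)
qed

text \<open>
  The arrow \<open>p\<close> is the image in \<open>X \<otimes> X\<close> of the Casimir element of \<open>A\<close>, as one sees by moving \<open>i\<^sup>*\<close> through the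
  Casimir element of \<open>X\<close>; so centrality of \<open>p\<close> is inherited from \<open>A\<close>.  Its product is a multiple of the
  unit since \<open>X\<close> is connected, and \<open>A\<close> is separable if this multiple is nonzero.
\<close>

lemma frobenius_subalgebra_idempotent:
  assumes X: "frobenius_algebra C X" and con: "connected_frob C X"
    and sub: "frobenius_subalgebra C X A i"
  defines "b \<equiv> Arrow (fobj X) (fobj X) (frob_idem C X A i)"
  defines "p \<equiv> (b \<otimes>\<^sub>a ida (fobj X)) \<circ>\<^sub>a casimir X"
  shows "subalgebra_idem X b" "duala (frob_dual C X) (frob_dual C X) b = b"
    and "mor (ep X \<circ>\<^sub>a mu X \<circ>\<^sub>a p) \<noteq> 0 \<Longrightarrow> \<exists>l. separability_elem X b p l"
proof -
  have A: "frobenius_algebra C A" using sub by (simp add: frobenius_subalgebra_def)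
  define j where "j = Arrow (fobj A) (fobj X) i"
  define s where "s = Arrow (fobj X) (fobj A) (frob_star C A X i)"
  note fs = frobenius_subalgebra_arrows[OF X sub, folded j_def s_def]
  note [simp] = frob_arr[OF X] arr_casimir[OF X] frob_arr[OF A] arr_casimir[OF A] fs(1,2)
  have [simp]: "src j = fobj A" "tgt j = fobj X" "src s = fobj X" "tgt s = fobj A"
    by (simp_all add: j_def s_def)
  have b: "b = j \<circ>\<^sub>a s" by (simp add: b_def j_def s_def cmp_def frob_idem_def)
  have sj: "s \<circ>\<^sub>a j \<circ>\<^sub>a h = h" if "arr h" "tgt h = fobj A" for h
    using fs(5) that by (simp flip: cmp_assoc)
  have mj: "mu X \<circ>\<^sub>a (j \<otimes>\<^sub>a j) \<circ>\<^sub>a h = j \<circ>\<^sub>a mu A \<circ>\<^sub>a h" if "arr h" "tgt h = fobj A \<boxdot> fobj A" for h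
    using fs(3) that by (simp flip: cmp_assoc)
  have bb: "b \<otimes>\<^sub>a b = (j \<otimes>\<^sub>a j) \<circ>\<^sub>a (s \<otimes>\<^sub>a s)" by (simp add: b interchange)
  show "subalgebra_idem X b"
    unfolding subalgebra_idem_def bb by (simp add: mj) (simp add: b sj)
  show "duala (frob_dual C X) (frob_dual C X) b = b"
    unfolding b using fs(6,7)
    by (subst duala_cmp[of _ _ "frob_dual C A"]) (simp_all add: frob_dual_is_left_dual A X)
  have p: "p = (j \<otimes>\<^sub>a j) \<circ>\<^sub>a casimir A"
  proof -
    have "(s \<otimes>\<^sub>a ida (fobj X)) \<circ>\<^sub>a casimir X = (ida (fobj A) \<otimes>\<^sub>a j) \<circ>\<^sub>a casimir A"
      using duala_coev[of s "frob_dual C X" "frob_dual C A"] fs(7)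
      by (simp add: frob_dual_is_left_dual A X frob_dual_ev)
    then have "(j \<otimes>\<^sub>a ida (fobj X)) \<circ>\<^sub>a (s \<otimes>\<^sub>a ida (fobj X)) \<circ>\<^sub>a casimir X =
        (j \<otimes>\<^sub>a ida (fobj X)) \<circ>\<^sub>a (ida (fobj A) \<otimes>\<^sub>a j) \<circ>\<^sub>a casimir A" by simp
    then show ?thesis by (simp add: p_def b interchange')
  qed
  have arrs [simp]: "arr b" "src b = fobj X" "tgt b = fobj X" "arr p" "src p = unit C" "tgt p = fobj X \<boxdot> fobj X"
    by (simp_all add: b p)
  assume tr: "mor (ep X \<circ>\<^sub>a mu X \<circ>\<^sub>a p) \<noteq> 0"
  obtain l where l: "mu X \<circ>\<^sub>a p = sca l (et X)"
    using connected_arrow[OF X con, of "mu X \<circ>\<^sub>a p"] by auto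
  have "l \<noteq> 0" using tr by (auto simp: l sca_simps mor_simps scl_zero)
  moreover have "(b \<otimes>\<^sub>a b) \<circ>\<^sub>a p = p"
    by (simp add: p b interchange interchange' fs(5) sj)
  moreover have "(mu X \<otimes>\<^sub>a ida (fobj X)) \<circ>\<^sub>a (b \<otimes>\<^sub>a p) = (ida (fobj X) \<otimes>\<^sub>a mu X) \<circ>\<^sub>a (p \<otimes>\<^sub>a b)"
  proof -
    have "(mu X \<otimes>\<^sub>a ida (fobj X)) \<circ>\<^sub>a (b \<otimes>\<^sub>a p) =
        ((mu X \<otimes>\<^sub>a ida (fobj X)) \<circ>\<^sub>a ((j \<otimes>\<^sub>a j) \<otimes>\<^sub>a j)) \<circ>\<^sub>a (s \<otimes>\<^sub>a casimir A)"
      by (simp add: b p interchange)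
    also have "(mu X \<otimes>\<^sub>a ida (fobj X)) \<circ>\<^sub>a ((j \<otimes>\<^sub>a j) \<otimes>\<^sub>a j) = (j \<otimes>\<^sub>a j) \<circ>\<^sub>a (mu A \<otimes>\<^sub>a ida (fobj A))"
      by (subst interchange) (simp_all add: fs(3) interchange)
    also have "s \<otimes>\<^sub>a casimir A = (ida (fobj A) \<otimes>\<^sub>a casimir A) \<circ>\<^sub>a s"
      using tns_split_right[of s "casimir A"] by simp
    finally have left: "(mu X \<otimes>\<^sub>a ida (fobj X)) \<circ>\<^sub>a (b \<otimes>\<^sub>a p) =
        (j \<otimes>\<^sub>a j) \<circ>\<^sub>a ((mu A \<otimes>\<^sub>a ida (fobj A)) \<circ>\<^sub>a (ida (fobj A) \<otimes>\<^sub>a casimir A)) \<circ>\<^sub>a s" by simp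
    have "(ida (fobj X) \<otimes>\<^sub>a mu X) \<circ>\<^sub>a (p \<otimes>\<^sub>a b) =
        ((ida (fobj X) \<otimes>\<^sub>a mu X) \<circ>\<^sub>a (j \<otimes>\<^sub>a j \<otimes>\<^sub>a j)) \<circ>\<^sub>a (casimir A \<otimes>\<^sub>a s)"
      using interchange[of "casimir A" "j \<otimes>\<^sub>a j" s j] by (simp add: b p)
    also have "(ida (fobj X) \<otimes>\<^sub>a mu X) \<circ>\<^sub>a (j \<otimes>\<^sub>a j \<otimes>\<^sub>a j) = (j \<otimes>\<^sub>a j) \<circ>\<^sub>a (ida (fobj A) \<otimes>\<^sub>a mu A)"
      by (subst interchange) (simp_all add: fs(3) interchange)
    also have "casimir A \<otimes>\<^sub>a s = (casimir A \<otimes>\<^sub>a ida (fobj A)) \<circ>\<^sub>a s"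
      using tns_split_left[of "casimir A" s] by simp
    finally have right: "(ida (fobj X) \<otimes>\<^sub>a mu X) \<circ>\<^sub>a (p \<otimes>\<^sub>a b) =
        (j \<otimes>\<^sub>a j) \<circ>\<^sub>a ((ida (fobj A) \<otimes>\<^sub>a mu A) \<circ>\<^sub>a (casimir A \<otimes>\<^sub>a ida (fobj A))) \<circ>\<^sub>a s" by simp
    show ?thesis
      unfolding left right by (simp only: casimir_left[OF A] casimir_right[OF A])
  qed
  ultimately show "\<exists>l. separability_elem X b p l" using l by (auto simp: separability_elem_def)
qed

text \<open>
  The trace of \<open>\<phi>\<^sub>A\<close> is formed with the dual chosen by \<open>D\<close>, which need not be the Frobenius dual of \<open>A\<close>.  With
  \<open>i\<^sup>*\<close> the Frobenius dual and \<open>k : X \<rightarrow> D(A)\<close> the dual of \<open>i\<close> relative to \<open>D\<close>, the coevaluation of \<open>A\<close> is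
  \<open>(i\<^sup>* \<otimes> k) \<cdot> coev\<^sub>X\<close>.  Moving \<open>k\<close> through the evaluation turns \<open>\<phi>\<^sub>A\<close> into \<open>i\<^sup>*\<^sup>* \<cdot> \<phi>\<^sub>A = \<phi>\<^sub>X \<cdot> i = i\<close>, and only \<open>b = i \<cdot> i\<^sup>*\<close>
  remains.
\<close>

lemma trace_of_subalgebra:
  assumes X: "frobenius_algebra C X" and sub: "frobenius_subalgebra C X A i"
    and D: "duality C D" and DX: "D (fobj X) = frob_dual C X"
    and qp: "quasi_pivotal C D \<phi>" and id: "\<phi> (fobj X) = idm C (fobj X)"
  defines "b \<equiv> Arrow (fobj X) (fobj X) (frob_idem C X A i)"
  shows "tr C D (fobj A) (\<phi> (fobj A)) =
    scalar_of C (mor (ep X \<circ>\<^sub>a mu X \<circ>\<^sub>a (b \<otimes>\<^sub>a ida (fobj X)) \<circ>\<^sub>a casimir X))"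
proof -
  have A: "frobenius_algebra C A" using sub by (simp add: frobenius_subalgebra_def)
  define j where "j = Arrow (fobj A) (fobj X) i"
  define s where "s = Arrow (fobj X) (fobj A) (frob_star C A X i)"
  define a where "a = dobj (D (fobj A))"
  define aa where "aa = dobj (D a)"
  define h where "h = Arrow (fobj A) aa (\<phi> (fobj A))"
  note fs = frobenius_subalgebra_arrows[OF X sub, folded j_def s_def]
  have l: "is_left_dual C Y (D Y)" for Y using D by (simp add: duality_def)
  note [simp] = frob_arr[OF X] arr_casimir[OF X] fs(1,2) l left_dual_arr(1,2)[OF l]
    frob_dual_is_left_dual[OF X]
  have [simp]: "src j = fobj A" "tgt j = fobj X" "src s = fobj X" "tgt s = fobj A"
      "src h = fobj A" "tgt h = aa" "mor h = \<phi> (fobj A)" "dobj (D (fobj A)) = a" "dobj (D a) = aa"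
    by (simp_all add: j_def s_def h_def a_def aa_def)
  have b: "b = j \<circ>\<^sub>a s" by (simp add: b_def j_def s_def cmp_def frob_idem_def)
  have "iso_in C (fobj A) aa (\<phi> (fobj A))"
    using qp unfolding quasi_pivotal_def ddual_obj_def a_def aa_def by blast
  then have [simp]: "arr h" unfolding iso_in_def arr_def by simp
  define k where "k = duala (D (fobj A)) (frob_dual C X) j"
  define kk where "kk = duala (frob_dual C X) (D a) k"
  have [simp]: "arr k" "src k = fobj X" "tgt k = a" by (simp_all add: k_def)
  have [simp]: "arr kk" "src kk = aa" "tgt kk = fobj X" by (simp_all add: kk_def)
  have nat: "kk \<circ>\<^sub>a h = j"
  proof -
    have "ddual_mor C D (fobj A) (fobj X) i \<cdot> \<phi> (fobj A) = \<phi> (fobj X) \<cdot> i"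
      using qp fs(1) unfolding quasi_pivotal_def arr_def j_def arrow.sel by blast
    also have "\<dots> = i" using fs(1) by (simp add: id arr_def j_def comp_idm_left)
    finally have "mor (kk \<circ>\<^sub>a h) = mor j"
      by (simp add: mor_simps kk_def k_def duala_def ddual_mor_def DX j_def)
    then show ?thesis by (intro arrow_eqI) simp_all
  qed
  have co: "coeva (fobj A) (D (fobj A)) = (s \<otimes>\<^sub>a k) \<circ>\<^sub>a casimir X"
  proof -
    have "(ida (fobj X) \<otimes>\<^sub>a k) \<circ>\<^sub>a casimir X = (j \<otimes>\<^sub>a ida a) \<circ>\<^sub>a coeva (fobj A) (D (fobj A))"
      using duala_coev[of j "D (fobj A)" "frob_dual C X"] by (simp add: k_def frob_dual_ev)
    then have "(s \<otimes>\<^sub>a ida a) \<circ>\<^sub>a (ida (fobj X) \<otimes>\<^sub>a k) \<circ>\<^sub>a casimir X =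
        (s \<otimes>\<^sub>a ida a) \<circ>\<^sub>a (j \<otimes>\<^sub>a ida a) \<circ>\<^sub>a coeva (fobj A) (D (fobj A))" by simp
    then show ?thesis by (simp add: interchange' fs(5))
  qed
  have ev: "eva a (D a) \<circ>\<^sub>a (ida aa \<otimes>\<^sub>a k) = ep X \<circ>\<^sub>a mu X \<circ>\<^sub>a (kk \<otimes>\<^sub>a ida (fobj X))"
    using duala_ev[of k "frob_dual C X" "D a"] by (simp add: kk_def frob_dual_ev)
  have "eva a (D a) \<circ>\<^sub>a (h \<otimes>\<^sub>a ida a) \<circ>\<^sub>a coeva (fobj A) (D (fobj A)) =
      (eva a (D a) \<circ>\<^sub>a (ida aa \<otimes>\<^sub>a k)) \<circ>\<^sub>a ((h \<circ>\<^sub>a s) \<otimes>\<^sub>a ida (fobj X)) \<circ>\<^sub>a casimir X"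
    unfolding co by (simp add: interchange')
  also have "\<dots> = ep X \<circ>\<^sub>a mu X \<circ>\<^sub>a (((kk \<circ>\<^sub>a h) \<circ>\<^sub>a s) \<otimes>\<^sub>a ida (fobj X)) \<circ>\<^sub>a casimir X"
    unfolding ev by (simp add: interchange')
  also have "\<dots> = ep X \<circ>\<^sub>a mu X \<circ>\<^sub>a (b \<otimes>\<^sub>a ida (fobj X)) \<circ>\<^sub>a casimir X"
    unfolding nat b ..
  finally have "mor (eva a (D a) \<circ>\<^sub>a (h \<otimes>\<^sub>a ida a) \<circ>\<^sub>a coeva (fobj A) (D (fobj A))) =
      mor (ep X \<circ>\<^sub>a mu X \<circ>\<^sub>a (b \<otimes>\<^sub>a ida (fobj X)) \<circ>\<^sub>a casimir X)" by simp
  then show ?thesis using tr_arrow[OF D, of h "fobj A"] by (simp add: ddual_obj_def)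
qed

lemma frobenius_subalgebra_separable:
  assumes X: "frobenius_algebra C X" and con: "connected_frob C X" and one: "idm C (unit C) \<noteq> 0"
    and D: "duality C D" and DX: "D (fobj X) = frob_dual C X" and wp: "weakly_positive C D \<phi>"
    and mult: "fmul X \<cdot> (\<phi> (fobj X) \<boxtimes> \<phi> (fobj X)) = \<phi> (fobj X) \<cdot> fmul X"
    and sub: "frobenius_subalgebra C X A i"
  defines "b \<equiv> Arrow (fobj X) (fobj X) (frob_idem C X A i)"
  shows "\<exists>l. separability_elem X b ((b \<otimes>\<^sub>a ida (fobj X)) \<circ>\<^sub>a casimir X) l"
proof -
  have id: "\<phi> (fobj X) = idm C (fobj X)" by (rule pivotal_identity[OF X con one D DX wp mult])
  have "\<not> zero_object C (fobj A)"
  proof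
    assume z: "zero_object C (fobj A)"
    have A: "frobenius_algebra C A" using sub by (simp add: frobenius_subalgebra_def)
    have "funit A = 0" using z frob_arr(3)[OF A] by (auto simp: zero_object_def arr_def et_def)
    moreover have "et X = Arrow (fobj A) (fobj X) i \<circ>\<^sub>a sca 0 (et A)"
    proof -
      have "sca 0 (et A) = et A"
        using \<open>funit A = 0\<close> by (intro arrow_eqI) (simp_all add: mor_simps scl_zero et_def)
      then show ?thesis using frobenius_subalgebra_arrows(4)[OF X sub] by simp
    qed
    moreover have "\<dots> = sca 0 (Arrow (fobj A) (fobj X) i \<circ>\<^sub>a et A)"
      using frobenius_subalgebra_arrows(1)[OF X sub] frob_arr(3)[OF A] by (simp add: sca_simps)
    ultimately have "mor (et X) = 0" by (simp add: mor_simps scl_zero)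
    with frob_unit_nonzero[OF X con] show False by (simp add: et_def)
  qed
  then have "tr C D (fobj A) (\<phi> (fobj A)) \<noteq> 0" using wp by (auto simp: weakly_positive_def)
  then have "mor (ep X \<circ>\<^sub>a mu X \<circ>\<^sub>a (b \<otimes>\<^sub>a ida (fobj X)) \<circ>\<^sub>a casimir X) \<noteq> 0"
  proof -
    have "quasi_pivotal C D \<phi>" using wp by (simp add: weakly_positive_def)
    from trace_of_subalgebra[OF X sub D DX this id] show ?thesis
      using \<open>tr C D (fobj A) (\<phi> (fobj A)) \<noteq> 0\<close> scalar_of_zero[OF one] unfolding b_def by auto
  qed
  then show ?thesis
    using frobenius_subalgebra_idempotent(3)[OF X con sub] by (simp add: b_def)
qed

section \<open>Finiteness of the set of Frobenius subalgebras\<close>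

text \<open>
  With these facts, the operators of the rigidity argument are seen to be linear from the way in which they
  are composed.
\<close>

lemma lin_map_Hom:
  shows lin_map_precomp: "f \<in> Hom C X Y \<Longrightarrow> lin_map (scl C) (Hom C Y Z) (Hom C X Z) (\<lambda>g. g \<cdot> f)"
    and lin_map_postcomp: "g \<in> Hom C Y Z \<Longrightarrow> lin_map (scl C) (Hom C X Y) (Hom C X Z) (\<lambda>f. g \<cdot> f)"
    and lin_map_tensor_left: "g \<in> Hom C Z W \<Longrightarrow>
        lin_map (scl C) (Hom C X Y) (Hom C (X \<boxdot> Z) (Y \<boxdot> W)) (\<lambda>f. f \<boxtimes> g)"
    and lin_map_tensor_right: "f \<in> Hom C X Y \<Longrightarrow>
        lin_map (scl C) (Hom C Z W) (Hom C (X \<boxdot> Z) (Y \<boxdot> W)) (\<lambda>g. f \<boxtimes> g)"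
    and lin_map_scl: "lin_map (scl C) (Hom C X Y) (Hom C X Y) (\<lambda>f. scl C c f)"
proof -
  interpret vector_space "scl C" by (rule vector_space_scl)
  show "f \<in> Hom C X Y \<Longrightarrow> lin_map (scl C) (Hom C Y Z) (Hom C X Z) (\<lambda>g. g \<cdot> f)"
    unfolding lin_map_def using comp_Hom comp_add_left comp_scl_left by blast
  show "g \<in> Hom C Y Z \<Longrightarrow> lin_map (scl C) (Hom C X Y) (Hom C X Z) (\<lambda>f. g \<cdot> f)"
    unfolding lin_map_def using comp_Hom comp_add_right comp_scl_right by blast
  show "g \<in> Hom C Z W \<Longrightarrow> lin_map (scl C) (Hom C X Y) (Hom C (X \<boxdot> Z) (Y \<boxdot> W)) (\<lambda>f. f \<boxtimes> g)"
    unfolding lin_map_def using tmor_Hom tmor_add_left tmor_scl_left by blast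
  show "f \<in> Hom C X Y \<Longrightarrow> lin_map (scl C) (Hom C Z W) (Hom C (X \<boxdot> Z) (Y \<boxdot> W)) (\<lambda>g. f \<boxtimes> g)"
    unfolding lin_map_def using tmor_Hom tmor_add_right tmor_scl_right by blast
  show "lin_map (scl C) (Hom C X Y) (Hom C X Y) (\<lambda>f. scl C c f)"
    unfolding lin_map_def using subspaceD(2) by (simp add: scale_right_distrib mult.commute)
qed

lemma lin_map_diff:
  assumes "lin_map (scl C) U (Hom C X Y) f" "lin_map (scl C) U (Hom C X Y) g"
  shows "lin_map (scl C) U (Hom C X Y) (\<lambda>x. f x - g x)"
proof -
  interpret vector_space "scl C" by (rule vector_space_scl)
  show ?thesis using assms unfolding lin_map_def
    by (simp add: subspaceD scale_right_diff_distrib)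
qed

definition unit_coeff :: "('a, 'b) frob \<Rightarrow> 'b \<Rightarrow> complex" where
  "unit_coeff X f = (THE c. f = scl C c (funit X))"

lemma unit_coeff_eqI:
  assumes "frobenius_algebra C X" "connected_frob C X" "f \<in> Hom C (unit C) (fobj X)" "f = scl C c (funit X)"
  shows "unit_coeff X f = c"
  unfolding unit_coeff_def using connected_scalar[OF assms(1-3)] assms(4) by (intro the1_equality)

lemma lin_map_unit_coeff:
  assumes X: "frobenius_algebra C X" and con: "connected_frob C X"
    and F: "lin_map (scl C) U (Hom C (unit C) (fobj X)) F" and d: "d \<in> Hom C Y Z"
  shows "lin_map (scl C) U (Hom C Y Z) (\<lambda>x. scl C (unit_coeff X (F x)) d)"
proof -
  interpret vector_space "scl C" by (rule vector_space_scl)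
  have co: "f = scl C (unit_coeff X f) (funit X)" if "f \<in> Hom C (unit C) (fobj X)" for f
    unfolding unit_coeff_def by (rule theI') (rule connected_scalar[OF X con that])
  have add: "unit_coeff X (f + g) = unit_coeff X f + unit_coeff X g"
    if "f \<in> Hom C (unit C) (fobj X)" "g \<in> Hom C (unit C) (fobj X)" for f g
    by (rule unit_coeff_eqI[OF X con]) (use that co[OF that(1)] co[OF that(2)] in
        \<open>simp_all add: subspaceD scale_left_distrib\<close>)
  have scl: "unit_coeff X (scl C c f) = c * unit_coeff X f" if "f \<in> Hom C (unit C) (fobj X)" for f c
  proof (rule unit_coeff_eqI[OF X con])
    show "scl C c f = scl C (c * unit_coeff X f) (funit X)"
      using arg_cong[OF co[OF that], of "scl C c"] by simp
  qed (use that in \<open>simp add: subspaceD\<close>)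
  show ?thesis
    using F d unfolding lin_map_def by (simp add: add scl subspaceD scale_left_distrib)
qed

end

context tensor_category
begin

text \<open>
  The finiteness criterion is applied to the operators \<open>K\<^sub>b(x)\<close> on \<open>Hom(X, X)\<close>, the order of subalgebras being
  expressed by \<open>x \<cdot> b = b\<close>.
\<close>

theorem finite_idempotents:
  assumes X: "frobenius_algebra C X" and con: "connected_frob C X"
    and D: "duality C D" and DX: "D (fobj X) = frob_dual C X" and wp: "weakly_positive C D \<phi>"
    and mult: "fmul X \<cdot> (\<phi> (fobj X) \<boxtimes> \<phi> (fobj X)) = \<phi> (fobj X) \<cdot> fmul X"
  shows "finite {frob_idem C X A i | A i. frobenius_subalgebra C X A i}" (is "finite ?S")
proof -
  interpret vector_space "scl C" by (rule vector_space_scl)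
  let ?A = "fobj X" and ?I = "ida (fobj X)" and ?V = "Hom C (fobj X) (fobj X)"
  define ar where "ar f = Arrow ?A ?A f" for f :: 'b
  define P where "P b = (ar b \<otimes>\<^sub>a ?I) \<circ>\<^sub>a casimir X" for b
  define K where "K b x d = scl C (unit_coeff X (mor (mu X \<circ>\<^sub>a (ar x \<otimes>\<^sub>a ?I) \<circ>\<^sub>a P b))) d -
      mor ((?I \<ominus>\<^sub>a ar x) \<circ>\<^sub>a insertion X (ar b) (P b) (ar x) (ar d))" for b x d
  note [simp] = frob_arr[OF X] arr_casimir[OF X]
  have ar [simp]: "src (ar f) = ?A" "tgt (ar f) = ?A" "mor (ar f) = f" "f \<in> ?V \<Longrightarrow> arr (ar f)" for f
    by (simp_all add: ar_def arr_def)
  have P [simp]: "b \<in> ?V \<Longrightarrow> arr (P b)" "src (P b) = unit C" "tgt (P b) = ?A \<boxdot> ?A" for b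
    by (simp_all add: P_def)
  have S: "subalgebra_idem X (ar b) \<and> duala (frob_dual C X) (frob_dual C X) (ar b) = ar b \<and>
      (\<exists>l. separability_elem X (ar b) (P b) l)" if "b \<in> ?S" for b
    using that frobenius_subalgebra_idempotent(1,2)[OF X con]
      frobenius_subalgebra_separable[OF X con idm_unit_nonzero D DX wp mult]
    unfolding ar_def P_def by blast
  have SV: "?S \<subseteq> ?V"
    using S by (fastforce simp: subalgebra_idem_def arr_def)
  obtain B where B: "finite B" "?V = span B" using Hom_finite_dim by blast
  have scalar: "\<exists>c. f = sca c (et X) \<and> unit_coeff X (mor f) = c" if f: "arr f" "src f = unit C" "tgt f = ?A" for f
  proof -
    obtain c where "f = sca c (et X)" using connected_arrow[OF X con f] by blast
    moreover from this f have "unit_coeff X (mor f) = c"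
      by (intro unit_coeff_eqI[OF X con]) (simp_all add: arr_def mor_simps et_def)
    ultimately show ?thesis by blast
  qed
  \<comment> \<open>To see that \<open>K\<close> is linear in \<open>d\<close> and quadratic in \<open>x\<close>, it is written in terms of morphisms
    with the parts that depend on neither of them collected in \<open>n b\<close> and \<open>w b\<close>.\<close>
  define n where "n b = mor (mu X \<circ>\<^sub>a (ar b \<otimes>\<^sub>a ar b))" for b
  define w where "w b = mor (?I \<otimes>\<^sub>a P b)" for b
  have Hm: "fmul X \<in> Hom C (?A \<boxdot> ?A) ?A" using frob_arr(1)[OF X] by (simp add: arr_def mu_def)
  have Hn: "n b \<in> Hom C (?A \<boxdot> ?A) ?A" if "b \<in> ?V" for b
    unfolding n_def by (rule arrD) (use that in simp_all)
  have Hw: "w b \<in> Hom C ?A ((?A \<boxdot> ?A) \<boxdot> ?A)" if "b \<in> ?V" for b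
    unfolding w_def by (rule arrD) (use that in simp_all)
  have HP: "mor (P b) \<in> Hom C (unit C) (?A \<boxdot> ?A)" if "b \<in> ?V" for b
    by (rule arrD) (use that in simp_all)
  have K: "K b x d = scl C (unit_coeff X (fmul X \<cdot> ((x \<boxtimes> idm C ?A) \<cdot> mor (P b)))) d -
      (idm C ?A - x) \<cdot> (fmul X \<cdot> (((x \<cdot> n b) \<boxtimes> d) \<cdot> w b))" for b x d
    by (simp add: K_def insertion_def n_def w_def mor_simps mor_dif) (simp add: mu_def)
  have F: "lin_map (scl C) ?V (Hom C (unit C) ?A) (\<lambda>x. fmul X \<cdot> ((x \<boxtimes> idm C ?A) \<cdot> mor (P b)))"
    if "b \<in> ?V" for b
    by (rule lin_map_comp[OF lin_map_comp[OF lin_map_tensor_left[OF idm_Hom] lin_map_precomp[OF HP[OF that]]]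
          lin_map_postcomp[OF Hm]])
  have Gd: "lin_map (scl C) ?V ?V (\<lambda>d. fmul X \<cdot> (((x \<cdot> n b) \<boxtimes> d) \<cdot> w b))" if "b \<in> ?V" "x \<in> ?V" for b x
    by (rule lin_map_comp[OF lin_map_comp[OF lin_map_tensor_right[OF comp_Hom[OF Hn[OF that(1)] that(2)]]
          lin_map_precomp[OF Hw[OF that(1)]]] lin_map_postcomp[OF Hm]])
  have Gx: "lin_map (scl C) ?V ?V (\<lambda>x. fmul X \<cdot> (((x \<cdot> n b) \<boxtimes> d) \<cdot> w b))" if "b \<in> ?V" "d \<in> ?V" for b d
    by (rule lin_map_comp[OF lin_map_comp[OF lin_map_comp[OF lin_map_precomp[OF Hn[OF that(1)]]
          lin_map_tensor_left[OF that(2)]] lin_map_precomp[OF Hw[OF that(1)]]] lin_map_postcomp[OF Hm]])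
  show ?thesis
  proof (rule finite_if_operators_degenerate[OF vector_space_scl B SV, where K = K and r = "\<lambda>b x. x \<cdot> b = b"])
    fix b x assume b: "b \<in> ?S" and x: "x \<in> ?S"
    then have bV: "b \<in> ?V" and xV: "x \<in> ?V" using SV by blast+
    show "lin_map (scl C) ?V ?V (K b x)"
      unfolding K
      by (intro lin_map_diff lin_map_scl
          lin_map_comp[OF Gd[OF bV xV] lin_map_postcomp] subspaceD idm_Hom xV)
  next
    fix b d assume b: "b \<in> ?S" and dV: "d \<in> ?V"
    then have bV: "b \<in> ?V" using SV by blast
    \<comment> \<open>Splitting \<open>1 - x\<close> into its two terms separates the linear part from the quadratic one, which
      is bilinear in the outer occurrence \<open>y\<close> and the inner occurrence \<open>z\<close> of \<open>x\<close>.\<close>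
    let ?L = "\<lambda>x. scl C (unit_coeff X (fmul X \<cdot> ((x \<boxtimes> idm C ?A) \<cdot> mor (P b)))) d - fmul X \<cdot> (((x \<cdot> n b) \<boxtimes> d) \<cdot> w b)"
    let ?Q = "\<lambda>y z. y \<cdot> (fmul X \<cdot> (((z \<cdot> n b) \<boxtimes> d) \<cdot> w b))"
    have G: "fmul X \<cdot> (((x \<cdot> n b) \<boxtimes> d) \<cdot> w b) \<in> ?V" if "x \<in> ?V" for x
      using Gx[OF bV dV] that by (simp add: lin_map_def)
    have "K b x d = ?L x + ?Q x x" if "x \<in> ?S" for x
    proof -
      have xV: "x \<in> ?V" using that SV by blast
      let ?g = "fmul X \<cdot> (((x \<cdot> n b) \<boxtimes> d) \<cdot> w b)"
      have "(idm C ?A - x) \<cdot> ?g + x \<cdot> ?g = ?g"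
        using comp_add_left[OF G[OF xV] subspaceD(4)[OF idm_Hom xV] xV] comp_idm_left[OF G[OF xV]]
        by simp
      then show ?thesis by (simp add: K algebra_simps)
    qed
    moreover have "lin_map (scl C) ?V ?V ?L"
      by (intro lin_map_diff lin_map_unit_coeff[OF X con] F Gx bV dV)
    moreover have "lin_map (scl C) ?V ?V (?Q y)" if "y \<in> ?V" for y
      by (rule lin_map_comp[OF Gx[OF bV dV] lin_map_postcomp[OF that]])
    moreover have "lin_map (scl C) ?V ?V (\<lambda>y. ?Q y z)" if "z \<in> ?V" for z
      by (rule lin_map_precomp[OF G[OF that]])
    ultimately show "\<exists>L Q. lin_map (scl C) ?V ?V L \<and> (\<forall>y\<in>?V. lin_map (scl C) ?V ?V (Q y)) \<and>
        (\<forall>z\<in>?V. lin_map (scl C) ?V ?V (\<lambda>y. Q y z)) \<and> (\<forall>x\<in>?S. K b x d = L x + Q x x)"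
      by (intro exI[of _ ?L] exI[of _ ?Q] conjI ballI)
  next
    fix b assume b: "b \<in> ?S"
    then have bV: "b \<in> ?V" using SV by blast
    obtain l where l: "separability_elem X (ar b) (P b) l" and sub: "subalgebra_idem X (ar b)" using S[OF b] by blast
    have co: "unit_coeff X (mor (mu X \<circ>\<^sub>a (ar b \<otimes>\<^sub>a ?I) \<circ>\<^sub>a P b)) = l"
    proof (rule unit_coeff_eqI[OF X con])
      show "mor (mu X \<circ>\<^sub>a (ar b \<otimes>\<^sub>a ?I) \<circ>\<^sub>a P b) \<in> Hom C (unit C) ?A"
        by (rule arrD) (use bV in simp_all)
      show "mor (mu X \<circ>\<^sub>a (ar b \<otimes>\<^sub>a ?I) \<circ>\<^sub>a P b) = scl C l (funit X)"
        unfolding separability_elem_left[OF sub l] by (simp add: mor_simps et_def)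
    qed
    have "K b b d = scl C l d" if d: "d \<in> ?V" for d
    proof -
      obtain t where "mu X \<circ>\<^sub>a (ar b \<otimes>\<^sub>a ar d) \<circ>\<^sub>a P b = sca t (et X)"
        using scalar[of "mu X \<circ>\<^sub>a (ar b \<otimes>\<^sub>a ar d) \<circ>\<^sub>a P b"] d bV by auto
      from insertion_self[OF X sub l _ _ _ this] d show ?thesis by (simp add: K_def co)
    qed
    moreover have "l \<noteq> 0" using l by (simp add: separability_elem_def)
    ultimately show "\<exists>l. l \<noteq> 0 \<and> (\<forall>d\<in>?V. K b b d = scl C l d)" by blast
  next
    fix b x assume b: "b \<in> ?S" and x: "x \<in> ?S" and nle: "x \<cdot> b \<noteq> b"
    then have bV: "b \<in> ?V" and xV: "x \<in> ?V" using SV by blast+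
    obtain l where l: "separability_elem X (ar b) (P b) l" and sub: "subalgebra_idem X (ar b)" using S[OF b] by blast
    have subx: "subalgebra_idem X (ar x)" using S[OF x] by blast
    define d where "d = (?I \<ominus>\<^sub>a ar x) \<circ>\<^sub>a ar b"
    have d: "arr d" "src d = ?A" "tgt d = ?A" "ar (mor d) = d"
      using bV xV by (simp_all add: d_def) (simp add: ar_def cmp_def dif_def)
    have md: "mor d = b - x \<cdot> b"
      using bV xV by (simp add: d_def dif_simps) (simp add: mor_dif mor_simps)
    obtain u where u: "mu X \<circ>\<^sub>a (ar x \<otimes>\<^sub>a ?I) \<circ>\<^sub>a P b = sca u (et X)"
      "unit_coeff X (mor (mu X \<circ>\<^sub>a (ar x \<otimes>\<^sub>a ?I) \<circ>\<^sub>a P b)) = u"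
      using scalar[of "mu X \<circ>\<^sub>a (ar x \<otimes>\<^sub>a ?I) \<circ>\<^sub>a P b"] bV xV by auto
    have "K b x (mor d) = 0"
      using insertion_defect[OF X sub l subx u(1), folded d_def] u(2) d(4)
      by (simp add: K_def mor_simps)
    moreover have "mor d \<in> ?V" "mor d \<noteq> 0" using d nle md by (simp_all add: arr_def)
    ultimately show "\<exists>d\<in>?V. d \<noteq> 0 \<and> K b x d = 0" by blast
  next
    fix x y z assume "x \<in> ?S" "y \<in> ?S" "z \<in> ?S" and xy: "y \<cdot> x = x" and yz: "z \<cdot> y = y"
    then have "x \<in> ?V" "y \<in> ?V" "z \<in> ?V" using SV by blast+
    from comp_assoc[OF this] show "z \<cdot> x = x" by (simp add: xy yz)
  next
    fix x y assume x: "x \<in> ?S" and y: "y \<in> ?S" and xy: "y \<cdot> x = x" and yx: "x \<cdot> y = y"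
    then have V: "x \<in> ?V" "y \<in> ?V" using SV by blast+
    \<comment> \<open>Dualizing \<open>y \<cdot> x = x\<close> reverses the product, as \<open>x\<close> and \<open>y\<close> are fixed by the star.\<close>
    have "ar x = ar y \<circ>\<^sub>a ar x" by (simp add: ar_def cmp_def xy)
    then have "ar x = duala (frob_dual C X) (frob_dual C X) (ar y \<circ>\<^sub>a ar x)" using S[OF x] by simp
    also have "\<dots> = ar x \<circ>\<^sub>a ar y"
      using S[OF x] S[OF y] V
      by (subst duala_cmp[of _ _ "frob_dual C X"]) (simp_all add: frob_dual_is_left_dual X)
    also have "\<dots> = ar y" by (simp add: ar_def cmp_def yx)
    finally show "x = y" by (simp add: ar_def)
  qed
qed

end

lemma finite_frob_poset:
  assumes "finite {frob_idem C X A i | A i. frobenius_subalgebra C X A i}"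
  shows "finite (carrier (frob_poset C X))"
proof -
  let ?S = "{frob_idem C X A i | A i. frobenius_subalgebra C X A i}"
  let ?class = "\<lambda>b. {(B, j). (B, j) \<in> frob_subs C X \<and> frob_idem C X B j = b}"
  have "K \<in> ?class ` ?S" if mem: "K \<in> carrier (frob_poset C X)" for K
  proof -
    obtain A i where A: "(A, i) \<in> frob_subs C X" and K: "K = frob_class C X A i"
      using mem by (auto simp: frob_poset_def quotient_def)
    have "frob_idem C X A i \<in> ?S" using A by (auto simp: frob_subs_def)
    moreover have "K = ?class (frob_idem C X A i)"
      using A unfolding K frob_equiv_def by auto
    ultimately show ?thesis by (rule rev_image_eqI)
  qed
  then have "carrier (frob_poset C X) \<subseteq> ?class ` ?S" by blast
  with assms show ?thesis using finite_surj by blast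
qed

theorem corollary9p11:
  fixes C :: "('o, 'v::ab_group_add) tcat"
    and D :: "'o \<Rightarrow> ('o, 'v) dual_data"
    and \<phi> :: "'o \<Rightarrow> 'v"
    and X :: "('o, 'v) frob"
  assumes "semisimple_tensor_category C"
    and "duality C D"
    and "weakly_positive C D \<phi>"
    and "frobenius_algebra C X"
    and "connected_frob C X"
    and "D (fobj X) = frob_dual C X"
    and "fmul X \<cdot>\<^bsub>C\<^esub> (\<phi> (fobj X) \<boxtimes>\<^bsub>C\<^esub> \<phi> (fobj X)) = \<phi> (fobj X) \<cdot>\<^bsub>C\<^esub> fmul X"
  shows "(\<forall>L. coherent_sublattice C X L \<longrightarrow> finite L) \<and>
    (\<forall>R \<B>. object_basis C R (fobj X) \<B> \<longrightarrow>
       finite (carrier (frob_basis_lattice C D R \<B> X)))"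
proof -
  interpret semisimple_tensor_category C by fact
  have fin: "finite (carrier (frob_poset C X))"
    by (intro finite_frob_poset finite_idempotents[of X D \<phi>]) (use assms in auto)
  have "finite L" if "coherent_sublattice C X L" for L
    using that fin finite_subset unfolding coherent_sublattice_def by blast
  moreover have "finite (carrier (frob_basis_lattice C D R \<B> X))" for R \<B>
  proof -
    have "carrier (frob_basis_lattice C D R \<B> X) \<subseteq> carrier (frob_poset C X)"
      by (auto simp: frob_basis_lattice_def frob_poset_def frobenius_basis_subalgebra_def frob_subs_def quotientI)
    then show ?thesis using fin finite_subset by blast
  qed
  ultimately show ?thesis by blast
qed

end
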